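(* Let $\mathbf{k}$ be an associative division algebra with centre $Z(\mathbf{k})$, let $n\ge 1$ be an integer, and let $f:\mathbf{k}^n\to\mathbf{k}^n$ be an injective map which takes every left or right affine subspace to a left or right affine subspace (a left one is allowed to go to a right one and vice versa). Then the following holds. (1) The map $f$ is bijective and preserves dimensions, i.e. $\dim f(A)=\dim A$ for every left or right affine subspace $A\subset\mathbf{k}^n$. Now let $P\subset\mathbf{k}^n$ be a two-sided affine plane. (2) Suppose $n\ge 3$. If there exists a purely left affine line $L\subset P$ such that $f(L)$ is left, then the image under $f$ of every left affine subspace is a left affine subspace of the same dimension. Moreover, $f$ can be written as $f(x)=\sigma(g(xa)+b)$ for all $x\in\mathbf{k}^n$, where $a\in\mathbf{k}$, $b\in\mathbf{k}^n$, $\sigma$ is an automorphism of $\mathbf{k}$ (applied component-wise) and $g:\mathbf{k}^n\to\mathbf{k}^n$ is a map of left $\mathbf{k}$-vector spaces defined over $Z(\mathbf{k})$. (3) Suppose $n\ge 2$. If for every purely left affine line $L\subset P$ the image $f(L)$ is right, then $\mathbf{k}$ admits an anti-automorphism $\varepsilon$ such that the composition $h=\varepsilon\circ f$ (with $\varepsilon$ applied component-wise) is as in the conclusion of part (2): $h$ takes every left affine subspace to a left affine subspace of the same dimension, and $h(x)=\sigma(g(xa)+b)$ for all $x\in\mathbf{k}^n$, for some $a\in\mathbf{k}$, $b\in\mathbf{k}^n$, some automorphism $\sigma$ of $\mathbf{k}$ (applied component-wise) and some map $g:\mathbf{k}^n\to\mathbf{k}^n$ of left $\mathbf{k}$-vector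 spaces defined over $Z(\mathbf{k})$.
   Context: $\mathbf{k}^n$ is regarded as a $\mathbf{k}$-bimodule with component-wise left and right multiplication. A left (right) affine subspace of $\mathbf{k}^n$ is a translate of a left (right) $\mathbf{k}$-vector subspace; its dimension is the left (right) dimension of that vector subspace. An affine subspace is purely left if it is left but not right, purely right if it is right but not left, and two-sided if it is both left and right. For two-sided subspaces the left and right dimensions coincide, so one speaks simply of the dimension. "Left" alone means left, possibly two-sided; likewise for "right". Lines and planes are affine subspaces of dimension 1 and 2. A left linear map $g:\mathbf{k}^n\to\mathbf{k}^n$ is defined over $Z(\mathbf{k})$ if its matrix in the standard basis has all entries in $Z(\mathbf{k})$, i.e. $g(x)=xM'$ for a matrix $M'$ over $Z(\mathbf{k})$, with $x$ a row vector. For $a\in\mathbf{k}$, $xa$ is component-wise right multiplication. An anti-automorphism of $\mathbf{k}$ is an additive bijection $\varepsilon$ with $\varepsilon(xy)=\varepsilon(y)\varepsilon(x)$. *)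

theory Defs
  imports "HOL-Analysis.Finite_Cartesian_Product"
begin

text \<open>
  The linear algebra of the distribution (\<^locale>\<open>module\<close>, \<^locale>\<open>vector_space\<close>) is limited
  to commutative scalars.  The notions below are the same ones, with the scalar
  action as a parameter \<open>s\<close> that is instantiated with the left and with the right
  multiplication of a division ring.
\<close>

definition right_scale :: "'a::times \<Rightarrow> 'a ^ 'n \<Rightarrow> 'a ^ 'n" where
  "right_scale c x = (\<chi> i. x $ i * c)"

definition vsubspace :: "('a \<Rightarrow> 'v \<Rightarrow> 'v) \<Rightarrow> 'v::ab_group_add set \<Rightarrow> bool" where
  "vsubspace s V \<longleftrightarrow> 0 \<in> V \<and> (\<forall>x\<in>V. \<forall>y\<in>V. x + y \<in> V) \<and> (\<forall>c. \<forall>x\<in>V. s c x \<in> V)"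

definition vspan :: "('a \<Rightarrow> 'v \<Rightarrow> 'v) \<Rightarrow> 'v::ab_group_add set \<Rightarrow> 'v set" where
  "vspan s B = {(\<Sum>v\<in>T. s (u v) v) | T u. finite T \<and> T \<subseteq> B}"

definition vindependent :: "('a::zero \<Rightarrow> 'v \<Rightarrow> 'v) \<Rightarrow> 'v::ab_group_add set \<Rightarrow> bool" where
  "vindependent s B \<longleftrightarrow>
     (\<forall>T u. finite T \<longrightarrow> T \<subseteq> B \<longrightarrow> (\<Sum>v\<in>T. s (u v) v) = 0 \<longrightarrow> (\<forall>v\<in>T. u v = 0))"

definition vdim :: "('a::zero \<Rightarrow> 'v \<Rightarrow> 'v) \<Rightarrow> 'v::ab_group_add set \<Rightarrow> nat" where
  "vdim s V = card (SOME B. B \<subseteq> V \<and> vindependent s B \<and> vspan s B = V)"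

definition affine_subspace :: "('a \<Rightarrow> 'v \<Rightarrow> 'v) \<Rightarrow> 'v::ab_group_add set \<Rightarrow> bool" where
  "affine_subspace s A \<longleftrightarrow> (\<exists>V p. vsubspace s V \<and> A = (\<lambda>v. p + v) ` V)"

definition direction :: "'v::ab_group_add set \<Rightarrow> 'v set" where
  "direction A = {x - y | x y. x \<in> A \<and> y \<in> A}"

abbreviation left_affine :: "('a::division_ring ^ 'n) set \<Rightarrow> bool" where
  "left_affine A \<equiv> affine_subspace (*s) A"

abbreviation right_affine :: "('a::division_ring ^ 'n) set \<Rightarrow> bool" where
  "right_affine A \<equiv> affine_subspace right_scale A"

definition purely_left :: "('a::division_ring ^ 'n) set \<Rightarrow> bool" where
  "purely_left A \<longleftrightarrow> left_affine A \<and> \<not> right_affine A"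

definition two_sided :: "('a::division_ring ^ 'n) set \<Rightarrow> bool" where
  "two_sided A \<longleftrightarrow> left_affine A \<and> right_affine A"

text \<open>
  Only meaningful for left or right affine subspaces.  On two-sided ones the left and
  the right dimension agree, so that giving precedence to the left one is harmless.
\<close>

definition affine_dim :: "('a::division_ring ^ 'n) set \<Rightarrow> nat" where
  "affine_dim A =
     (if left_affine A then vdim (*s) (direction A) else vdim right_scale (direction A))"

definition centre :: "'a::times set" where
  "centre = {z. \<forall>x. z * x = x * z}"

definition ring_automorphism :: "('a::ring_1 \<Rightarrow> 'a) \<Rightarrow> bool" where
  "ring_automorphism \<sigma> \<longleftrightarrow> bij \<sigma> \<and> (\<forall>x y. \<sigma> (x + y) = \<sigma> x + \<sigma> y) \<and> (\<forall>x y. \<sigma> (x * y) = \<sigma> x * \<sigma> y)"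

definition ring_anti_automorphism :: "('a::ring_1 \<Rightarrow> 'a) \<Rightarrow> bool" where
  "ring_anti_automorphism \<epsilon> \<longleftrightarrow>
     bij \<epsilon> \<and> (\<forall>x y. \<epsilon> (x + y) = \<epsilon> x + \<epsilon> y) \<and> (\<forall>x y. \<epsilon> (x * y) = \<epsilon> y * \<epsilon> x)"

definition componentwise :: "('a \<Rightarrow> 'b) \<Rightarrow> 'a ^ 'n \<Rightarrow> 'b ^ 'n" where
  "componentwise \<phi> x = (\<chi> i. \<phi> (x $ i))"

definition left_linear :: "('a::division_ring ^ 'n \<Rightarrow> 'a ^ 'n) \<Rightarrow> bool" where
  "left_linear g \<longleftrightarrow> (\<forall>x y. g (x + y) = g x + g y) \<and> (\<forall>c x. g (c *s x) = c *s g x)"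

text \<open>
  Vectors are rows, \<open>g x = x M\<close>, so the rows of the matrix \<open>M\<close> of a left linear map
  \<open>g\<close> are the images of the standard basis vectors.
\<close>

definition defined_over_centre :: "('a::division_ring ^ 'n \<Rightarrow> 'a ^ 'n) \<Rightarrow> bool" where
  "defined_over_centre g \<longleftrightarrow> (\<forall>i j. g (axis i 1) $ j \<in> centre)"

definition preserves_left_affine :: "('a::division_ring ^ 'n \<Rightarrow> 'a ^ 'n) \<Rightarrow> bool" where
  "preserves_left_affine f \<longleftrightarrow>
     (\<forall>A. left_affine A \<longrightarrow> left_affine (f ` A) \<and> affine_dim (f ` A) = affine_dim A)"

definition has_standard_form :: "('a::division_ring ^ 'n \<Rightarrow> 'a ^ 'n) \<Rightarrow> bool" where
  "has_standard_form f \<longleftrightarrow>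
     (\<exists>a b \<sigma> g. ring_automorphism \<sigma> \<and> left_linear g \<and> defined_over_centre g \<and>
        (\<forall>x. f x = componentwise \<sigma> (g (right_scale a x) + b)))"

end

theory Submission
  imports Defs
begin

text \<open>
  The set of leading positions of the vectors of a left or right subspace determines its dimension
  and does not refer to the side, so that dimension is strictly monotone even for a left subspace
  inside a right one.  Images of full flags then give (1).

  Two points whose difference is not central lie on exactly one left and one right line, and \<open>f\<close>
  keeps or exchanges the types of this pair.  A left plane that is not two-sided has an image of the
  same kind, which contains no lines of the wrong type except two-sided ones; for \<open>n \<ge> 3\<close> such
  planes connect all lines, so that the behaviour is the same everywhere.  The exchanging case is
  the keeping one for the composition with the canonical map to the opposite ring.  A two-sided line
  also goes to a left line: for \<open>n \<ge> 3\<close> it lies in a purely left plane, and for \<open>n = 2\<close>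
  see \<open>central_line_left_2\<close> below.  By the fundamental theorem of affine geometry \<open>f\<close> is
  semilinear up to a translation.  By symmetry it preserves two-sided lines, so the rows of its
  matrix and their pairwise sums are left multiples of central vectors, and the left factor is the
  same for all rows.
\<close>

section \<open>Leading positions and dimension\<close>

text \<open>Over a noncommutative ring a left basis says nothing about right spans, so the two kinds
  of subspace need a common measure that depends only on which coordinates vanish. The ring may
  admit no anti-automorphism at the outset, hence the detour over the opposite ring, and maps
  between two different rings. In (3) the anti-automorphism is a product of the proof: the composed
  map turns out semilinear along an isomorphism onto the opposite ring. The bound 3 supplies a
  direction outside a two-sided plane; tilting the plane by it destroys two-sidedness. In dimension
  2 the only plane is the whole space, but there the hypothesis of (3) speaks of every purely left
  line. One computation, \<open>central_sum_scale\<close>, is behind all statements about a common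
  left factor: the factor \<open>a\<close> of the standard form, the set avoided in
  \<open>central_line_left_2\<close>, and the existence of a purely left line in \<open>P\<close>.
  Commutative rings are treated apart, since the arguments about two-sided lines need two elements
  that do not commute.\<close>

definition idx :: "'n::finite \<Rightarrow> nat" where
  "idx = (SOME e. inj e)"

lemma inj_idx: "inj (idx :: 'n::finite \<Rightarrow> nat)"
proof -
  have "\<exists>e :: 'n \<Rightarrow> nat. inj e"
    using finite_imp_inj_to_nat_seg[of "UNIV :: 'n set"] by auto
  then show ?thesis unfolding idx_def by (rule someI_ex)
qed

text \<open>The coordinates are ordered by the arbitrary numbering \<open>idx\<close>, as the index
  type has no order of its own. Only the vanishing of coordinates counts, which a nonzero factor on
  either side leaves unchanged.\<close>

definition lead :: "'a::zero ^ 'n::finite \<Rightarrow> 'n \<Rightarrow> bool" where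
  "lead x i \<longleftrightarrow> x $ i \<noteq> 0 \<and> (\<forall>j. idx j < idx i \<longrightarrow> x $ j = 0)"

lemma lead_exists:
  assumes "x \<noteq> 0"
  shows "\<exists>i. lead x i"
proof -
  obtain k where "x $ k \<noteq> 0" using assms by (auto simp: vec_eq_iff)
  then obtain i where "x $ i \<noteq> 0" "\<And>j. x $ j \<noteq> 0 \<Longrightarrow> idx i \<le> idx j"
    using arg_min_nat_lemma[of "\<lambda>i. x $ i \<noteq> 0" k idx] by blast
  then show ?thesis unfolding lead_def by (meson leD)
qed

lemma lead_unique: "lead x i \<Longrightarrow> lead x j \<Longrightarrow> i = j"
  unfolding lead_def by (metis inj_idx injD linorder_neqE_nat)

text \<open>The pivot columns of an echelon form, read off without choosing a basis.\<close>

definition pivots :: "('a::zero ^ 'n::finite) set \<Rightarrow> 'n set" where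
  "pivots V = {i. \<exists>x\<in>V. lead x i}"

definition pivot_dim :: "('a::zero ^ 'n::finite) set \<Rightarrow> nat" where
  "pivot_dim V = card (pivots V)"

lemma pivots_mono: "V \<subseteq> W \<Longrightarrow> pivots V \<subseteq> pivots W"
  unfolding pivots_def by blast

lemma pivot_dim_le_CARD: "pivot_dim (V :: ('a::zero ^ 'n::finite) set) \<le> CARD('n)"
  unfolding pivot_dim_def by (intro card_mono) auto

lemma pivot_dim_UNIV: "pivot_dim (UNIV :: ('a::zero_neq_one ^ 'n::finite) set) = CARD('n)"
proof -
  have "lead (axis i 1 :: 'a ^ 'n) i" for i
    by (auto simp: lead_def axis_def)
  then have "pivots (UNIV :: ('a ^ 'n) set) = UNIV"
    unfolding pivots_def by blast
  then show ?thesis by (simp add: pivot_dim_def)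
qed

lemma pivot_dim_singleton_0: "pivot_dim {0} = 0"
  by (simp add: pivot_dim_def pivots_def lead_def)

text \<open>Covers both multiplications. \<open>s_s\<close> leaves the product unnamed because
  factors compose in opposite orders on the two sides; \<open>s_solve\<close> is what Gaussian
  elimination needs.\<close>

locale scaling =
  fixes s :: "'a::division_ring \<Rightarrow> 'a ^ 'n::finite \<Rightarrow> 'a ^ 'n"
  assumes s_add: "s c (x + y) = s c x + s c y"
    and add_s: "s (c + d) x = s c x + s d x"
    and s_s: "\<exists>e. \<forall>x. s c (s d x) = s e x"
    and s_one: "s 1 x = x"
    and s_inverse: "c \<noteq> 0 \<Longrightarrow> \<exists>e. \<forall>x. s e (s c x) = x"
    and s_coord: "s c x $ i = 0 \<longleftrightarrow> c = 0 \<or> x $ i = 0"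
    and s_solve: "x $ i \<noteq> 0 \<Longrightarrow> \<exists>c. s c x $ i = a"
begin

lemma s_zero_left [simp]: "s 0 x = 0"
  using add_s[of 0 0 x] by simp

lemma s_zero_right [simp]: "s c 0 = 0"
  using s_add[of c 0 0] by simp

lemma s_minus_one: "s (- 1) x = - x"
  using add_s[of 1 "- 1" x] by (simp add: s_one eq_neg_iff_add_eq_0 add.commute)

lemma s_sum: "s c (sum g T) = (\<Sum>v\<in>T. s c (g v))"
  by (induction T rule: infinite_finite_induct) (auto simp: s_add)

lemma sub_zero: "vsubspace s V \<Longrightarrow> 0 \<in> V"
  and sub_add: "vsubspace s V \<Longrightarrow> x \<in> V \<Longrightarrow> y \<in> V \<Longrightarrow> x + y \<in> V"
  and sub_scale: "vsubspace s V \<Longrightarrow> x \<in> V \<Longrightarrow> s c x \<in> V"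
  by (auto simp: vsubspace_def)

lemma sub_uminus: "vsubspace s V \<Longrightarrow> x \<in> V \<Longrightarrow> - x \<in> V"
  using sub_scale[of V x "- 1"] by (simp add: s_minus_one)

lemma sub_diff: "vsubspace s V \<Longrightarrow> x \<in> V \<Longrightarrow> y \<in> V \<Longrightarrow> x - y \<in> V"
  using sub_add[of V x "- y"] sub_uminus by simp

lemma sub_sum: "vsubspace s V \<Longrightarrow> (\<And>v. v \<in> T \<Longrightarrow> g v \<in> V) \<Longrightarrow> sum g T \<in> V"
  by (induction T rule: infinite_finite_induct) (auto simp: sub_zero sub_add)

lemma sub_scale_iff:
  assumes "vsubspace s V" "c \<noteq> 0"
  shows "s c x \<in> V \<longleftrightarrow> x \<in> V"
  using assms sub_scale s_inverse by metis

lemma lead_scale: "c \<noteq> 0 \<Longrightarrow> lead (s c x) i \<longleftrightarrow> lead x i"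
  by (simp add: lead_def s_coord)

text \<open>Elimination of \<open>b\<close> by vectors of \<open>V\<close>: take \<open>v\<close>
  such that the leading position of \<open>b - v\<close> comes as late as possible. Were it a pivot
  of \<open>V\<close>, one more subtraction would push it further.\<close>

lemma sub_reduce:
  assumes V: "vsubspace s V"
    and "b \<notin> V"
  obtains v i where "v \<in> V" "lead (b - v) i" "i \<notin> pivots V"
proof -
  define Q where "Q i \<longleftrightarrow> (\<exists>v\<in>V. lead (b - v) i)" for i
  have "b \<noteq> 0" using assms sub_zero by blast
  then obtain i0 where "lead b i0" using lead_exists by blast
  then have "Q i0" unfolding Q_def using sub_zero[OF V] by (intro bexI[of _ 0]) auto
  moreover have "\<forall>y. Q y \<longrightarrow> idx y < Suc (Max (range (idx :: 'n \<Rightarrow> nat)))"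
    by (simp add: le_imp_less_Suc)
  ultimately obtain i where i: "Q i" "\<And>j. Q j \<Longrightarrow> idx j \<le> idx i"
    using Lattices_Big.ex_has_greatest_nat[of Q i0 idx] by (metis less_or_eq_imp_le)
  then obtain v where v: "v \<in> V" "lead (b - v) i" unfolding Q_def by blast
  have "i \<notin> pivots V"
  proof
    assume "i \<in> pivots V"
    then obtain x where x: "x \<in> V" "lead x i" unfolding pivots_def by blast
    then obtain c where c: "s c x $ i = (b - v) $ i" using s_solve unfolding lead_def by metis
    have "v + s c x \<in> V" using x v V sub_add sub_scale by blast
    moreover then have "b - (v + s c x) \<noteq> 0" using assms by auto
    then obtain j where j: "lead (b - (v + s c x)) j" using lead_exists by blast
    ultimately have "Q j" unfolding Q_def by blast
    then have ji: "idx j \<le> idx i" using i by blast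
    have "(b - (v + s c x)) $ j = 0"
    proof (cases "j = i")
      case True then show ?thesis using c by simp
    next
      case False
      then have "idx j < idx i" using ji inj_idx by (metis injD le_neq_implies_less)
      then have "(b - v) $ j = 0" "x $ j = 0" using v x unfolding lead_def by blast+
      then have "s c x $ j = 0" by (simp add: s_coord)
      with \<open>(b - v) $ j = 0\<close> show ?thesis by simp
    qed
    then show False using j by (simp add: lead_def)
  qed
  with v show ?thesis using that by blast
qed

text \<open>\<open>W\<close> need not be closed under \<open>s\<close>, which allows comparing a left with a right subspace.\<close>

lemma sub_eqI:
  assumes V: "vsubspace s V" and W: "\<And>x y. x \<in> W \<Longrightarrow> y \<in> W \<Longrightarrow> x - y \<in> W"
    and "V \<subseteq> W" "pivot_dim W \<le> pivot_dim V"
  shows "V = W"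
proof (rule ccontr)
  assume "V \<noteq> W"
  then obtain b where b: "b \<in> W" "b \<notin> V" using assms by blast
  obtain v i where v: "v \<in> V" "lead (b - v) i" "i \<notin> pivots V" using sub_reduce[OF V b(2)] .
  then have "i \<in> pivots W" using W b \<open>V \<subseteq> W\<close> unfolding pivots_def by blast
  moreover have "pivots V = pivots W"
    using assms(3,4) by (intro card_subset_eq pivots_mono) (auto simp: pivot_dim_def pivots_mono card_mono le_antisym)
  ultimately show False using v by blast
qed

text \<open>Spans grow by one generator at a time; \<open>add_ray {0} v\<close> later serves as the
  span of a single vector.\<close>

definition add_ray :: "('a ^ 'n) set \<Rightarrow> 'a ^ 'n \<Rightarrow> ('a ^ 'n) set" where
  "add_ray V b = {v + s c b | v c. v \<in> V}"

lemma sub_add_ray: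
  assumes "vsubspace s V"
  shows "vsubspace s (add_ray V b)"
  unfolding vsubspace_def
proof (intro conjI ballI allI)
  show "0 \<in> add_ray V b" unfolding add_ray_def using sub_zero[OF assms]
    by (auto intro!: exI[of _ 0])
next
  fix x y assume "x \<in> add_ray V b" "y \<in> add_ray V b"
  then obtain v c w d where "x = v + s c b" "y = w + s d b" "v \<in> V" "w \<in> V"
    unfolding add_ray_def by blast
  moreover then have "x + y = (v + w) + s (c + d) b" by (simp add: add_s)
  ultimately show "x + y \<in> add_ray V b" unfolding add_ray_def using sub_add[OF assms] by blast
next
  fix x c assume "x \<in> add_ray V b"
  then obtain v d where "x = v + s d b" "v \<in> V"
    unfolding add_ray_def by blast
  moreover then obtain e where "s c x = s c v + s e b" using s_add s_s by metis
  ultimately show "s c x \<in> add_ray V b" unfolding add_ray_def using sub_scale[OF assms] by blast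
qed

lemma add_ray_supset: "V \<subseteq> add_ray V b"
  unfolding add_ray_def by (force intro: exI[of _ 0])

lemma add_ray_mem: "vsubspace s V \<Longrightarrow> b \<in> add_ray V b"
  unfolding add_ray_def using sub_zero s_one by (metis (mono_tags, lifting) add_0 mem_Collect_eq)

lemma add_ray_least: "vsubspace s W \<Longrightarrow> V \<subseteq> W \<Longrightarrow> b \<in> W \<Longrightarrow> add_ray V b \<subseteq> W"
  unfolding add_ray_def using sub_add sub_scale by blast

text \<open>After reducing \<open>b\<close> to \<open>b - v\<close>, its leading position
  \<open>i\<close> differs from every pivot of \<open>V\<close>. So nothing cancels at the front of
  \<open>w' + s c (b - v)\<close>, whose leading position is the earlier of the two.\<close>

lemma pivot_dim_add_ray:
  assumes V: "vsubspace s V" and "b \<notin> V"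
  shows "pivot_dim (add_ray V b) = Suc (pivot_dim V)"
proof -
  obtain v i where v: "v \<in> V" "lead (b - v) i" "i \<notin> pivots V" using sub_reduce[OF assms] .
  have "pivots (add_ray V b) = insert i (pivots V)"
  proof (intro equalityI subsetI)
    fix j assume "j \<in> pivots (add_ray V b)"
    then obtain w c where w: "w \<in> V" "lead (w + s c b) j"
      unfolding pivots_def add_ray_def by blast
    define w' where "w' = w + s c v"
    have w': "w' \<in> V" unfolding w'_def using w v V sub_add sub_scale by blast
    have "w + s c b = w' + s c (b - v)"
      unfolding w'_def using s_add[of c "b - v" v] by (simp add: algebra_simps)
    with w have l: "lead (w' + s c (b - v)) j" by simp
    show "j \<in> insert i (pivots V)"
    proof (cases "c = 0 \<or> w' = 0")
      case True
      then show ?thesis using l w' v(2) lead_scale lead_unique unfolding pivots_def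
        by (cases "c = 0") auto
    next
      case False
      then obtain k where k: "lead w' k" using lead_exists by blast
      have li: "lead (s c (b - v)) i" using False v lead_scale by blast
      have "k \<in> pivots V" using k w' pivots_def by blast
      then have "k \<noteq> i" using v by blast
      then have "idx k \<noteq> idx i" using inj_idx injD by metis
      then consider "idx k < idx i" | "idx i < idx k" by linarith
      then have "lead (w' + s c (b - v)) (if idx k < idx i then k else i)"
        using li k unfolding lead_def by cases auto
      then show ?thesis using l lead_unique \<open>k \<in> pivots V\<close> by (metis insertI1 insertI2)
    qed
  next
    fix j assume "j \<in> insert i (pivots V)"
    moreover have "b - v \<in> add_ray V b"
      using v V sub_add_ray add_ray_supset add_ray_mem sub_diff by blast
    ultimately show "j \<in> pivots (add_ray V b)"
      using v pivots_mono[OF add_ray_supset[of V b]] unfolding pivots_def by blast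
  qed
  then show ?thesis using v by (simp add: pivot_dim_def)
qed

section \<open>Spans, bases and dimension\<close>

lemma sub_vspan: "vsubspace s (vspan s B)"
  unfolding vsubspace_def
proof (intro conjI ballI allI)
  show "0 \<in> vspan s B" unfolding vspan_def by (auto intro!: exI[of _ "{}"])
next
  fix x y assume "x \<in> vspan s B" "y \<in> vspan s B"
  then obtain T u T' u' where T: "x = (\<Sum>v\<in>T. s (u v) v)" "finite T" "T \<subseteq> B"
    "y = (\<Sum>v\<in>T'. s (u' v) v)" "finite T'" "T' \<subseteq> B"
    unfolding vspan_def by blast
  define w where "w v = (if v \<in> T then u v else 0) + (if v \<in> T' then u' v else 0)" for v
  have "x = (\<Sum>v\<in>T \<union> T'. s (if v \<in> T then u v else 0) v)"
    unfolding T(1) using T by (intro sum.mono_neutral_cong_left) auto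
  moreover have "y = (\<Sum>v\<in>T \<union> T'. s (if v \<in> T' then u' v else 0) v)"
    unfolding T(4) using T by (intro sum.mono_neutral_cong_left) auto
  ultimately have "x + y = (\<Sum>v\<in>T \<union> T'. s (w v) v)"
    by (simp add: w_def add_s sum.distrib)
  then show "x + y \<in> vspan s B" unfolding vspan_def using T by blast
next
  fix x c assume "x \<in> vspan s B"
  then obtain T u where T: "x = (\<Sum>v\<in>T. s (u v) v)" "finite T" "T \<subseteq> B"
    unfolding vspan_def by blast
  obtain h where "\<And>d x. s c (s d x) = s (h d) x" using s_s by metis
  then have "s c x = (\<Sum>v\<in>T. s (h (u v)) v)" unfolding T(1) by (simp add: s_sum)
  then show "s c x \<in> vspan s B" unfolding vspan_def using T(2,3)
    by (intro CollectI exI[of _ T] exI[of _ "\<lambda>v. h (u v)"]) auto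
qed

lemma vspan_superset: "B \<subseteq> vspan s B"
proof
  fix b assume "b \<in> B"
  then show "b \<in> vspan s B" unfolding vspan_def
    by (auto intro!: exI[of _ "{b}"] exI[of _ "\<lambda>_. 1"] simp: s_one)
qed

lemma vspan_least: "vsubspace s V \<Longrightarrow> B \<subseteq> V \<Longrightarrow> vspan s B \<subseteq> V"
proof -
  assume V: "vsubspace s V" "B \<subseteq> V"
  show "vspan s B \<subseteq> V"
  proof
    fix x assume "x \<in> vspan s B"
    then obtain T u where T: "x = (\<Sum>v\<in>T. s (u v) v)" "T \<subseteq> B" unfolding vspan_def by blast
    show "x \<in> V" unfolding T(1) using T(2) V by (intro sub_sum sub_scale) auto
  qed
qed

lemma vspan_insert: "vspan s (insert b B) = add_ray (vspan s B) b"
proof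
  show "vspan s (insert b B) \<subseteq> add_ray (vspan s B) b"
    using vspan_superset[of B] add_ray_supset[of "vspan s B" b] add_ray_mem[OF sub_vspan, of b B]
    by (intro vspan_least sub_add_ray sub_vspan) auto
  show "add_ray (vspan s B) b \<subseteq> vspan s (insert b B)"
    using vspan_superset[of "insert b B"] by (intro add_ray_least vspan_least sub_vspan) auto
qed

lemma vindependent_subset: "vindependent s B \<Longrightarrow> B' \<subseteq> B \<Longrightarrow> vindependent s B'"
  unfolding vindependent_def by blast

lemma vindependent_insertD:
  assumes "vindependent s (insert b B)" "b \<notin> B"
  shows "b \<notin> vspan s B"
proof
  assume "b \<in> vspan s B"
  then obtain T u where T: "b = (\<Sum>v\<in>T. s (u v) v)" "finite T" "T \<subseteq> B"
    unfolding vspan_def by blast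
  define w where "w = u(b := - 1)"
  have "(\<Sum>v\<in>insert b T. s (w v) v) = s (w b) b + (\<Sum>v\<in>T. s (w v) v)"
    using T assms by (intro sum.insert) auto
  also have "(\<Sum>v\<in>T. s (w v) v) = b"
    unfolding T(1) using T assms by (intro sum.cong) (auto simp: w_def)
  finally have "(\<Sum>v\<in>insert b T. s (w v) v) = 0" by (simp add: w_def s_minus_one)
  moreover have "finite (insert b T)" "insert b T \<subseteq> insert b B" using T by auto
  ultimately have "\<forall>v\<in>insert b T. w v = 0" using assms(1) unfolding vindependent_def by blast
  then have "w b = 0" by blast
  then show False by (simp add: w_def)
qed

lemma vindependent_insertI:
  assumes "vindependent s B" "b \<notin> vspan s B"
  shows "vindependent s (insert b B)"
  unfolding vindependent_def
proof (intro allI impI)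
  fix T u assume T: "finite T" "T \<subseteq> insert b B" and z: "(\<Sum>v\<in>T. s (u v) v) = 0"
  have ub: "u b = 0" if "b \<in> T"
  proof (rule ccontr)
    assume "u b \<noteq> 0"
    have "s (u b) b = - (\<Sum>v\<in>T - {b}. s (u v) v)"
      using z T that by (simp add: sum.remove eq_neg_iff_add_eq_0)
    also have "\<dots> \<in> vspan s B"
      using T vspan_superset[of B] by (intro sub_uminus sub_vspan sub_sum sub_scale) auto
    finally show False using assms(2) sub_scale_iff[OF sub_vspan \<open>u b \<noteq> 0\<close>] by blast
  qed
  have "(\<Sum>v\<in>T - {b}. s (u v) v) = 0"
    using z T ub by (cases "b \<in> T") (auto simp: sum.remove)
  moreover have "finite (T - {b})" "T - {b} \<subseteq> B" using T by auto
  ultimately have "\<forall>v\<in>T - {b}. u v = 0"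
    using assms(1) unfolding vindependent_def by blast
  then show "\<forall>v\<in>T. u v = 0" using ub by blast
qed

lemma pivot_dim_vspan: "finite B \<Longrightarrow> vindependent s B \<Longrightarrow> pivot_dim (vspan s B) = card B"
proof (induction B rule: finite_induct)
  case empty
  have "vspan s {} = {0}" unfolding vspan_def by auto
  then show ?case by (simp add: pivot_dim_singleton_0)
next
  case (insert b B)
  then show ?case
    using vindependent_insertD vindependent_subset[of "insert b B" B] pivot_dim_add_ray[OF sub_vspan]
    by (metis card_insert_disjoint subset_insertI vspan_insert)
qed

lemma vindependent_finite:
  assumes "vindependent s B"
  shows "finite B"
proof (rule ccontr)
  assume "infinite B"
  then obtain T where T: "T \<subseteq> B" "finite T" "card T = Suc CARD('n)"
    using infinite_arbitrarily_large by blast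
  then show False using pivot_dim_vspan vindependent_subset assms pivot_dim_le_CARD
    by (metis not_less_eq_eq order_refl)
qed

text \<open>Independent sets have at most \<open>CARD('n)\<close> elements, so a largest one inside
  \<open>V\<close> exists, and it must span. Hence the choice in \<open>vdim\<close> picks a genuine
  basis, whose size is the number of pivots.\<close>

lemma vdim_eq_pivot_dim:
  assumes V: "vsubspace s V"
  shows "vdim s V = pivot_dim V"
proof -
  define Q where "Q B \<longleftrightarrow> B \<subseteq> V \<and> vindependent s B" for B
  have "Q {}" by (simp add: Q_def vindependent_def)
  moreover have "\<forall>B. Q B \<longrightarrow> card B < Suc CARD('n)"
    using pivot_dim_vspan vindependent_finite pivot_dim_le_CARD unfolding Q_def by (metis less_Suc_eq_le)
  ultimately obtain B where B: "Q B" "\<And>B'. Q B' \<Longrightarrow> card B' \<le> card B"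
    using Lattices_Big.ex_has_greatest_nat[of Q "{}" card] by (metis less_or_eq_imp_le)
  have "vspan s B = V"
  proof (rule ccontr)
    assume "vspan s B \<noteq> V"
    then obtain b where b: "b \<in> V" "b \<notin> vspan s B"
      using B vspan_least[OF V] unfolding Q_def by blast
    then have "Q (insert b B)" using B vindependent_insertI unfolding Q_def by blast
    moreover have "b \<notin> B" "finite B"
      using b vspan_superset B vindependent_finite unfolding Q_def by blast+
    ultimately show False using B(2)[of "insert b B"] by simp
  qed
  then have "\<exists>B. B \<subseteq> V \<and> vindependent s B \<and> vspan s B = V" using B unfolding Q_def by blast
  moreover define B0 where "B0 = (SOME B. B \<subseteq> V \<and> vindependent s B \<and> vspan s B = V)"
  ultimately have "B0 \<subseteq> V \<and> vindependent s B0 \<and> vspan s B0 = V"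
    by (metis (mono_tags, lifting) someI_ex)
  then show ?thesis
    unfolding vdim_def B0_def[symmetric] using pivot_dim_vspan[OF vindependent_finite, of B0] by simp
qed

text \<open>Vanishing of a coordinate is preserved by either multiplication, so the cut with a
  coordinate hyperplane stays a subspace; adding back one vector that is nonzero there recovers
  \<open>V\<close>.\<close>

lemma sub_hyperplane:
  assumes V: "vsubspace s V" and "V \<noteq> {0}"
  obtains W where "vsubspace s W" "W \<subseteq> V" "Suc (pivot_dim W) = pivot_dim V"
proof -
  obtain x where "x \<in> V" "x \<noteq> 0" using assms sub_zero by blast
  then obtain i0 where "i0 \<in> pivots V" using lead_exists pivots_def by blast
  then obtain i where i: "i \<in> pivots V" "\<And>j. j \<in> pivots V \<Longrightarrow> idx i \<le> idx j"
    using arg_min_nat_lemma[of "\<lambda>i. i \<in> pivots V" i0 idx] by blast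
  define W where "W = {v \<in> V. v $ i = 0}"
  have W: "vsubspace s W" unfolding vsubspace_def W_def
    using V by (auto simp: sub_zero sub_add sub_scale s_coord)
  obtain b where b: "b \<in> V" "lead b i" using i pivots_def by blast
  have "b \<notin> W" using b by (simp add: W_def lead_def)
  have "add_ray W b = V"
  proof
    show "add_ray W b \<subseteq> V" using V b by (intro add_ray_least) (auto simp: W_def)
    show "V \<subseteq> add_ray W b"
    proof
      fix v assume "v \<in> V"
      obtain c where c: "s c b $ i = v $ i" using b s_solve lead_def by metis
      have "v - s c b \<in> W" using c \<open>v \<in> V\<close> b sub_diff[OF V] sub_scale[OF V] by (simp add: W_def)
      then show "v \<in> add_ray W b" unfolding add_ray_def
        by (intro CollectI exI[of _ "v - s c b"] exI[of _ c]) auto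
    qed
  qed
  then show ?thesis using that[of W] W pivot_dim_add_ray[OF W \<open>b \<notin> W\<close>] by (auto simp: W_def)
qed

end

interpretation left: scaling "(*s) :: 'a::division_ring \<Rightarrow> 'a ^ 'n::finite \<Rightarrow> 'a ^ 'n"
proof
  fix x :: "'a ^ 'n" and c d a :: 'a and i :: 'n
  show "\<exists>e. \<forall>x :: 'a ^ 'n. c *s (d *s x) = e *s x"
    by (intro exI[of _ "c * d"]) (simp add: vec_eq_iff mult.assoc)
  show "\<exists>e. \<forall>x :: 'a ^ 'n. e *s (c *s x) = x" if "c \<noteq> 0"
    using that by (intro exI[of _ "inverse c"]) (simp add: vec_eq_iff mult.assoc[symmetric])
  show "\<exists>c. (c *s x) $ i = a" if "x $ i \<noteq> 0"
    using that by (intro exI[of _ "a * inverse (x $ i)"]) (simp add: mult.assoc)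
qed (auto simp: vec_eq_iff algebra_simps)

interpretation right: scaling "right_scale :: 'a::division_ring \<Rightarrow> 'a ^ 'n::finite \<Rightarrow> 'a ^ 'n"
proof
  fix x :: "'a ^ 'n" and c d a :: 'a and i :: 'n
  show "\<exists>e. \<forall>x :: 'a ^ 'n. right_scale c (right_scale d x) = right_scale e x"
    by (intro exI[of _ "d * c"]) (simp add: right_scale_def vec_eq_iff mult.assoc)
  show "\<exists>e. \<forall>x :: 'a ^ 'n. right_scale e (right_scale c x) = x" if "c \<noteq> 0"
    using that by (intro exI[of _ "inverse c"]) (simp add: right_scale_def vec_eq_iff mult.assoc)
  show "\<exists>c. (right_scale c x) $ i = a" if "x $ i \<noteq> 0"
    using that by (intro exI[of _ "inverse (x $ i) * a"]) (simp add: right_scale_def mult.assoc[symmetric])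
qed (auto simp: right_scale_def vec_eq_iff algebra_simps)

section \<open>Lines and affine subspaces\<close>

lemma left_right_scale: "c *s right_scale d x = right_scale d (c *s (x :: 'a::division_ring ^ 'n))"
  by (simp add: right_scale_def vec_eq_iff mult.assoc)

lemma direction_translate:
  assumes "0 \<in> V" "\<And>x y. x \<in> V \<Longrightarrow> y \<in> V \<Longrightarrow> x - y \<in> V"
  shows "direction ((\<lambda>v. p + v) ` V) = V"
proof
  show "direction ((\<lambda>v. p + v) ` V) \<subseteq> V" unfolding direction_def using assms by auto
  show "V \<subseteq> direction ((\<lambda>v. p + v) ` V)"
  proof
    fix v assume "v \<in> V"
    then have "v = (p + v) - (p + 0)" "p + v \<in> (\<lambda>v. p + v) ` V" "p + 0 \<in> (\<lambda>v. p + v) ` V"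
      using assms(1) by (auto simp only: imageI) simp
    then show "v \<in> direction ((\<lambda>v. p + v) ` V)" unfolding direction_def by blast
  qed
qed

lemma direction_mono: "A \<subseteq> B \<Longrightarrow> direction A \<subseteq> direction B"
  unfolding direction_def by blast

lemma direction_memI: "x \<in> A \<Longrightarrow> y \<in> A \<Longrightarrow> x - y \<in> direction A"
  unfolding direction_def by blast

context scaling
begin

lemma affine_translate: "vsubspace s V \<Longrightarrow> affine_subspace s ((\<lambda>v. p + v) ` V)"
  unfolding affine_subspace_def by blast

lemma direction_translate_sub: "vsubspace s V \<Longrightarrow> direction ((\<lambda>v. p + v) ` V) = V"
  by (rule direction_translate) (auto intro: sub_zero sub_diff)

lemma affine_nonempty: "affine_subspace s A \<Longrightarrow> A \<noteq> {}"
  unfolding affine_subspace_def vsubspace_def by blast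

lemma sub_direction: "affine_subspace s A \<Longrightarrow> vsubspace s (direction A)"
  unfolding affine_subspace_def using direction_translate_sub by metis

lemma affine_eq_translate:
  assumes "affine_subspace s A" "p \<in> A"
  shows "A = (\<lambda>v. p + v) ` direction A"
proof -
  obtain V q where V: "vsubspace s V" "A = (\<lambda>v. q + v) ` V"
    using assms unfolding affine_subspace_def by blast
  then have d: "direction A = V" using direction_translate_sub by blast
  obtain u where u: "p = q + u" "u \<in> V" using assms V by blast
  show ?thesis unfolding d
  proof (intro equalityI subsetI)
    fix x assume "x \<in> A"
    then obtain v where v: "x = q + v" "v \<in> V" using V by blast
    then have "x = p + (v - u)" "v - u \<in> V" using u V sub_diff by auto
    then show "x \<in> (\<lambda>v. p + v) ` V" by blast
  next
    fix x assume "x \<in> (\<lambda>v. p + v) ` V"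
    then obtain v where v: "x = p + v" "v \<in> V" by blast
    then have "x = q + (u + v)" "u + v \<in> V" using u V sub_add by auto
    then show "x \<in> A" using V by blast
  qed
qed

lemma affine_mem_iff: "affine_subspace s A \<Longrightarrow> p \<in> A \<Longrightarrow> x \<in> A \<longleftrightarrow> x - p \<in> direction A"
  using affine_eq_translate[of A p] by (metis (no_types, lifting) add_diff_cancel_left' add_diff_eq image_iff)

definition line :: "'a ^ 'n \<Rightarrow> 'a ^ 'n \<Rightarrow> ('a ^ 'n) set" where
  "line p v = {p + s c v | c. True}"

lemma line_range: "line p v = range (\<lambda>c. p + s c v)"
  unfolding line_def by auto

lemma sub_singleton_0: "vsubspace s {0}"
  by (simp add: vsubspace_def)

lemma line_altdef: "line p v = (\<lambda>v. p + v) ` add_ray {0} v"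
  unfolding line_def add_ray_def by auto

lemma affine_line: "affine_subspace s (line p v)"
  unfolding line_altdef by (intro affine_translate sub_add_ray sub_singleton_0)

lemma direction_line: "direction (line p v) = add_ray {0} v"
  unfolding line_altdef by (intro direction_translate_sub sub_add_ray sub_singleton_0)

lemma pivot_dim_line: "v \<noteq> 0 \<Longrightarrow> pivot_dim (add_ray {0} v) = 1"
  using pivot_dim_add_ray[OF sub_singleton_0, of v] pivot_dim_singleton_0 by simp

lemma line_mem: "p \<in> line p v" "p + v \<in> line p v"
  unfolding line_def using s_zero_left[of v] s_one[of v] by (metis (mono_tags, lifting) add.right_neutral mem_Collect_eq)+

lemma mem_ray: "x \<in> add_ray {0} v \<longleftrightarrow> (\<exists>c. x = s c v)"
  unfolding add_ray_def by auto

lemma line_subset: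
  assumes "affine_subspace s A" "p \<in> A" "v \<in> direction A"
  shows "line p v \<subseteq> A"
proof -
  have "p + s c v \<in> A" for c
    using affine_mem_iff[OF assms(1,2)] sub_scale[OF sub_direction] assms by simp
  then show ?thesis unfolding line_def by blast
qed

lemma affine_eqI:
  assumes "affine_subspace s A" "affine_subspace s B" "A \<subseteq> B" "pivot_dim (direction B) \<le> pivot_dim (direction A)"
  shows "A = B"
proof -
  obtain p where p: "p \<in> A" using affine_nonempty assms by blast
  have "direction A = direction B"
    using assms by (intro sub_eqI direction_mono sub_diff sub_direction) (auto intro: sub_direction)
  then show ?thesis using affine_eq_translate assms p by (metis subsetD)
qed

lemma line_unique:
  assumes "affine_subspace s A" "pivot_dim (direction A) = 1" "p \<in> A" "q \<in> A" "p \<noteq> q"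
  shows "A = line p (q - p)"
  using assms
  by (intro affine_eqI[symmetric] line_subset affine_line)
     (auto simp: direction_line pivot_dim_line direction_memI)

lemma line_eq:
  assumes "q \<in> line p v" "w = s c v" "w \<noteq> 0"
  shows "line q w = line p v"
proof -
  have "v \<noteq> 0" using assms by auto
  show ?thesis
  proof (intro affine_eqI affine_line line_subset assms(1))
    show "w \<in> direction (line p v)" using assms by (auto simp: direction_line mem_ray)
    show "pivot_dim (direction (line p v)) \<le> pivot_dim (direction (line q w))"
      using \<open>v \<noteq> 0\<close> assms by (simp add: direction_line pivot_dim_line)
  qed
qed

lemma line_through:
  assumes "p \<in> line r v" "q \<in> line r v" "p \<noteq> q"
  shows "line p (q - p) = line r v"
proof -
  have "v \<noteq> 0" using assms unfolding line_def by auto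
  then show ?thesis
    using line_unique[OF affine_line _ assms] by (simp add: direction_line pivot_dim_line)
qed

lemma affine_hyperplane:
  assumes "affine_subspace s A" "pivot_dim (direction A) \<noteq> 0"
  obtains B where "affine_subspace s B" "B \<subset> A" "Suc (pivot_dim (direction B)) = pivot_dim (direction A)"
proof -
  obtain p where p: "p \<in> A" using affine_nonempty assms by blast
  have "direction A \<noteq> {0}" using assms pivot_dim_singleton_0 by metis
  then obtain W where W: "vsubspace s W" "W \<subseteq> direction A" "Suc (pivot_dim W) = pivot_dim (direction A)"
    using sub_hyperplane sub_direction assms by metis
  let ?B = "(\<lambda>v. p + v) ` W"
  have d: "direction ?B = W" by (rule direction_translate_sub[OF W(1)])
  moreover have "?B \<subseteq> A" using W p affine_eq_translate[OF assms(1) p] by blast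
  moreover have "?B \<noteq> A" using W d by (metis n_not_Suc_n)
  ultimately show ?thesis using that[of ?B] W affine_translate by auto
qed

lemma affine_extend:
  assumes "affine_subspace s A" "A \<noteq> UNIV"
  obtains B where "affine_subspace s B" "A \<subset> B" "pivot_dim (direction B) = Suc (pivot_dim (direction A))"
proof -
  obtain p where p: "p \<in> A" using affine_nonempty assms by blast
  obtain q where q: "q \<notin> A" using assms by blast
  let ?W = "add_ray (direction A) (q - p)" let ?B = "(\<lambda>v. p + v) ` ?W"
  have W: "vsubspace s ?W" by (intro sub_add_ray sub_direction assms)
  have "q - p \<notin> direction A" using affine_mem_iff assms p q by blast
  then have pdW: "pivot_dim ?W = Suc (pivot_dim (direction A))" by (intro pivot_dim_add_ray sub_direction assms)
  have d: "direction ?B = ?W" by (rule direction_translate_sub[OF W])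
  moreover have "A \<subseteq> ?B" using affine_eq_translate[OF assms(1) p] add_ray_supset by blast
  moreover have "?B \<noteq> A" using pdW d by (metis n_not_Suc_n)
  ultimately show ?thesis using that[of ?B] affine_translate[OF W] pdW by auto
qed

lemma sub_UNIV: "vsubspace s UNIV"
  by (simp add: vsubspace_def)

lemma affine_UNIV: "affine_subspace s UNIV"
  using affine_translate[OF sub_UNIV, of 0] by simp

end

section \<open>Left and right affine subspaces compared\<close>

lemma affine_dim_eq_pivot_dim:
  assumes "left_affine A \<or> right_affine A"
  shows "affine_dim A = pivot_dim (direction A)"
  using assms left.vdim_eq_pivot_dim right.vdim_eq_pivot_dim left.sub_direction right.sub_direction
  unfolding affine_dim_def by auto

lemma affine_strict_mono:
  fixes A B :: "('a::division_ring ^ 'n::finite) set"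
  assumes A: "left_affine A \<or> right_affine A" and B: "left_affine B \<or> right_affine B" and "A \<subset> B"
  shows "pivot_dim (direction A) < pivot_dim (direction B)"
proof (rule ccontr)
  assume "\<not> ?thesis"
  then have le: "pivot_dim (direction B) \<le> pivot_dim (direction A)" by simp
  have sub: "direction A \<subseteq> direction B" using assms by (intro direction_mono) auto
  have diff: "x - y \<in> direction B" if "x \<in> direction B" "y \<in> direction B" for x y
    using B that left.sub_diff left.sub_direction right.sub_diff right.sub_direction by blast
  have eq: "direction A = direction B"
    using A left.sub_eqI[OF left.sub_direction diff sub le] right.sub_eqI[OF right.sub_direction diff sub le]
    by blast
  obtain p where p: "p \<in> A" using A left.affine_nonempty right.affine_nonempty by blast
  then have "p \<in> B" using assms by blast
  then have "A = B" using A B p eq left.affine_mem_iff right.affine_mem_iff by blast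
  then show False using \<open>A \<subset> B\<close> by blast
qed

text \<open>By \<open>lines_eq_central\<close> these are exactly the vectors whose left and right
  lines coincide, that is, the directions of two-sided lines together with 0.\<close>

definition central_direction :: "'a::division_ring ^ 'n \<Rightarrow> bool" where
  "central_direction v \<longleftrightarrow> (\<exists>c z. v = c *s z \<and> (\<forall>i. z $ i \<in> centre))"

lemma central_commute: "z \<in> centre \<Longrightarrow> z * x = x * z"
  by (simp add: centre_def)

lemma centre_mult:
  fixes z w :: "'a::semigroup_mult"
  assumes "z \<in> centre" "w \<in> centre"
  shows "z * w \<in> centre"
proof -
  have "z * w * x = x * (z * w)" for x
    using assms by (metis central_commute mult.assoc)
  then show ?thesis by (simp add: centre_def)
qed

text \<open>Conjugation moves the scalar across a central \<open>z\<close>: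
  \<open>c * z * d = (c * d * inverse c) * (c * z)\<close>.\<close>

lemma central_directionD_right:
  assumes "central_direction (v :: 'a::division_ring ^ 'n::finite)"
  shows "\<exists>c. right_scale d v = c *s v"
proof (cases "v = 0")
  case True then show ?thesis by simp
next
  case False
  obtain c z where z: "v = c *s z" "\<forall>i. z $ i \<in> centre"
    using assms unfolding central_direction_def by blast
  then have "c \<noteq> 0" using False by auto
  then have "right_scale d v = (c * d * inverse c) *s v"
    using z by (simp add: vec_eq_iff right_scale_def mult.assoc central_commute[of "z $ _" d])
      (simp add: mult.assoc[symmetric])
  then show ?thesis by blast
qed

text \<open>Scale from the left so that coordinate \<open>i\<close> becomes 1. That coordinate
  forces the left factor belonging to \<open>d\<close> to be \<open>d\<close> itself, so every
  coordinate of the scaled vector commutes with \<open>d\<close>.\<close>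

lemma central_directionI_right:
  assumes "\<And>d. \<exists>c. right_scale d v = c *s (v :: 'a::division_ring ^ 'n::finite)"
  shows "central_direction v"
proof (cases "v = 0")
  case True then show ?thesis unfolding central_direction_def
    by (intro exI[of _ 0] exI[of _ 0]) (simp add: centre_def)
next
  case False
  then obtain i where i: "v $ i \<noteq> 0" by (auto simp: vec_eq_iff)
  define z where "z = inverse (v $ i) *s v"
  have "z $ j * d = d * z $ j" for j d
  proof -
    obtain c where c: "right_scale d v = c *s v" using assms by blast
    then have *: "v $ k * d = c * v $ k" for k by (metis right_scale_def vec_lambda_beta vector_smult_component)
    have "z $ j * d = inverse (v $ i) * (v $ j * d)" by (simp add: z_def mult.assoc)
    also have "\<dots> = inverse (v $ i) * c * v $ j" by (simp add: * mult.assoc)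
    also have "inverse (v $ i) * c = d * inverse (v $ i)"
    proof -
      have "inverse (v $ i) * c = inverse (v $ i) * (c * v $ i) * inverse (v $ i)"
        using i by (simp add: mult.assoc)
      also have "\<dots> = d * inverse (v $ i)" using i by (simp add: *[symmetric] mult.assoc[symmetric])
      finally show ?thesis .
    qed
    finally show ?thesis by (simp add: z_def mult.assoc)
  qed
  then have "\<forall>j. z $ j \<in> centre" by (simp add: centre_def)
  moreover have "v = (v $ i) *s z" using i by (simp add: z_def vec_eq_iff mult.assoc[symmetric])
  ultimately show ?thesis unfolding central_direction_def by blast
qed

lemma central_directionD_left:
  assumes "central_direction (v :: 'a::division_ring ^ 'n::finite)"
  shows "\<exists>c. d *s v = right_scale c v"
proof (cases "v = 0")
  case True then show ?thesis by simp
next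
  case False
  obtain c z where z: "v = c *s z" "\<forall>i. z $ i \<in> centre"
    using assms unfolding central_direction_def by blast
  then have "c \<noteq> 0" using False by auto
  then have "d *s v = right_scale (inverse c * d * c) v"
    using z by (simp add: vec_eq_iff right_scale_def mult.assoc central_commute[of "z $ _" "inverse c * (d * c)"])
      (simp add: mult.assoc[symmetric])
  then show ?thesis by blast
qed

lemma central_direction_lines:
  "central_direction v \<Longrightarrow> left.line p v = right.line p (v :: 'a::division_ring ^ 'n::finite)"
  using central_directionD_left[of v] central_directionD_right[of v]
  unfolding left.line_def right.line_def by (safe; metis)

lemma central_directionI_line:
  assumes "right.line p v \<subseteq> left.line p (v :: 'a::division_ring ^ 'n::finite)"
  shows "central_direction v"
proof (rule central_directionI_right)
  fix d
  have "p + right_scale d v \<in> left.line p v" using assms unfolding right.line_def by blast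
  then show "\<exists>c. right_scale d v = c *s v" unfolding left.line_def by auto
qed

lemma lines_eq_central:
  "left.line p v = right.line p v \<longleftrightarrow> central_direction (v :: 'a::division_ring ^ 'n::finite)"
  using central_direction_lines central_directionI_line by blast

text \<open>Source and target ring may differ, so that compositions with passages to or from the
  opposite ring are again instances.\<close>

locale lr_map =
  fixes F :: "'a::division_ring ^ 'n::finite \<Rightarrow> 'b::division_ring ^ 'n"
  assumes inj_F: "inj F"
    and lr: "left_affine A \<or> right_affine A \<Longrightarrow> left_affine (F ` A) \<or> right_affine (F ` A)"
begin

section \<open>Dimensions and bijectivity\<close>

lemma image_strict: "A \<subset> B \<Longrightarrow> F ` A \<subset> F ` B"
  using inj_F by (metis image_mono inj_image_eq_iff psubset_eq)

text \<open>Passing to a hyperplane loses one dimension in the source and, by strict inclusion, at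
  least one in the image.\<close>

lemma pivot_dim_image_ge:
  "left_affine A \<or> right_affine A \<Longrightarrow> pivot_dim (direction A) \<le> pivot_dim (direction (F ` A))"
proof (induction "pivot_dim (direction A)" arbitrary: A)
  case 0 then show ?case by simp
next
  case (Suc d)
  then obtain B where B: "left_affine B \<or> right_affine B" "B \<subset> A"
    "Suc (pivot_dim (direction B)) = pivot_dim (direction A)"
    using left.affine_hyperplane[of A] right.affine_hyperplane[of A] by (metis Zero_not_Suc)
  then have "d \<le> pivot_dim (direction (F ` B))" using Suc by (metis Suc_inject)
  also have "\<dots> < pivot_dim (direction (F ` A))"
    using B lr Suc.prems by (intro affine_strict_mono image_strict)
  finally show ?case using Suc by simp
qed

text \<open>The same upwards: one more dimension in the source gains at least one in the image. The
  induction is on the codimension and starts where \<open>CARD('n)\<close> bounds every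
  dimension.\<close>

lemma pivot_dim_image_le:
  "left_affine A \<or> right_affine A \<Longrightarrow> pivot_dim (direction (F ` A)) \<le> pivot_dim (direction A)"
proof (induction "CARD('n) - pivot_dim (direction A)" arbitrary: A)
  case 0 then show ?case using pivot_dim_le_CARD by (metis diff_is_0_eq dual_order.trans)
next
  case (Suc d)
  have "A \<noteq> UNIV"
  proof
    assume "A = UNIV"
    then have "direction A = UNIV" using left.direction_translate_sub[OF left.sub_UNIV, of 0] by simp
    then show False using Suc(2) pivot_dim_UNIV by (metis Zero_not_Suc diff_self_eq_0)
  qed
  then obtain B where B: "left_affine B \<or> right_affine B" "A \<subset> B"
    "pivot_dim (direction B) = Suc (pivot_dim (direction A))"
    using left.affine_extend[of A] right.affine_extend[of A] Suc.prems by metis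
  have "pivot_dim (direction (F ` A)) < pivot_dim (direction (F ` B))"
    using B lr Suc.prems by (intro affine_strict_mono image_strict)
  also have "\<dots> \<le> pivot_dim (direction B)" using B Suc(2) by (intro Suc(1)) auto
  finally show ?case using B by simp
qed

lemma pivot_dim_image:
  "left_affine A \<or> right_affine A \<Longrightarrow> pivot_dim (direction (F ` A)) = pivot_dim (direction A)"
  using pivot_dim_image_le pivot_dim_image_ge by (simp add: le_antisym)

lemma bij_F: "bij F"
proof -
  have U: "direction UNIV = (UNIV :: ('c::division_ring ^ 'n) set)"
    using left.direction_translate_sub[OF left.sub_UNIV, of 0] by simp
  have "pivot_dim (direction (range F)) = CARD('n)"
    using pivot_dim_image[of UNIV] left.affine_UNIV U pivot_dim_UNIV by metis
  moreover have "left_affine (range F) \<or> right_affine (range F)" using lr left.affine_UNIV by blast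
  moreover have "pivot_dim (direction (UNIV :: ('b ^ 'n) set)) = CARD('n)" using U pivot_dim_UNIV by metis
  ultimately have "range F = UNIV"
    using affine_strict_mono[of "range F" UNIV] left.affine_UNIV by (metis less_irrefl psubsetI top_greatest)
  then show ?thesis using inj_F by (simp add: bij_def)
qed

lemma affine_dim_image:
  assumes "left_affine A \<or> right_affine A"
  shows "affine_dim (F ` A) = affine_dim A"
  using assms lr[OF assms] pivot_dim_image by (simp add: affine_dim_eq_pivot_dim)

text \<open>The displacement in the image; it depends on the base point \<open>x\<close> as long as
  \<open>F\<close> is not known to be additive up to translation.\<close>

definition \<delta> :: "'a ^ 'n \<Rightarrow> 'a ^ 'n \<Rightarrow> 'b ^ 'n" where
  "\<delta> x v = F (x + v) - F x"

lemma \<delta>_nonzero: "v \<noteq> 0 \<Longrightarrow> \<delta> x v \<noteq> 0"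
  unfolding \<delta>_def using inj_F by (simp add: inj_eq)

lemma line_image_cases:
  assumes "left_affine A \<or> right_affine A" "pivot_dim (direction A) = 1" "x \<in> A" "x + v \<in> A" "v \<noteq> 0"
  shows "F ` A = left.line (F x) (\<delta> x v) \<or> F ` A = right.line (F x) (\<delta> x v)"
proof -
  have "pivot_dim (direction (F ` A)) = 1" using pivot_dim_image assms by metis
  moreover have "F x \<in> F ` A" "F (x + v) \<in> F ` A" "F x \<noteq> F (x + v)"
    using assms inj_F by (auto simp: inj_eq)
  ultimately show ?thesis unfolding \<delta>_def
    using lr[OF assms(1)] left.line_unique right.line_unique by blast
qed

lemma left_line_image:
  assumes "v \<noteq> 0"
  shows "F ` left.line x v = left.line (F x) (\<delta> x v) \<or> F ` left.line x v = right.line (F x) (\<delta> x v)"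
  using assms left.line_mem
  by (intro line_image_cases) (auto simp: left.affine_line left.direction_line left.pivot_dim_line)

lemma right_line_image:
  assumes "v \<noteq> 0"
  shows "F ` right.line x v = left.line (F x) (\<delta> x v) \<or> F ` right.line x v = right.line (F x) (\<delta> x v)"
  using assms right.line_mem
  by (intro line_image_cases) (auto simp: right.affine_line right.direction_line right.pivot_dim_line)

text \<open>Only one left and one right line pass through \<open>F x\<close> and
  \<open>F (x + v)\<close>. By injectivity the two distinct source lines have distinct images, so
  they fill these two places in some order. In particular the two target lines differ, and
  \<open>\<delta> x v\<close> is not central.\<close>

lemma pure_lines_image:
  assumes "\<not> central_direction v"
  shows "\<not> central_direction (\<delta> x v) \<and>
    ((F ` left.line x v = left.line (F x) (\<delta> x v) \<and> F ` right.line x v = right.line (F x) (\<delta> x v)) \<or>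
     (F ` left.line x v = right.line (F x) (\<delta> x v) \<and> F ` right.line x v = left.line (F x) (\<delta> x v)))"
proof -
  have "v \<noteq> 0" using assms central_directionI_right[of 0] by auto
  moreover have "F ` left.line x v \<noteq> F ` right.line x v"
    using inj_F assms lines_eq_central by (metis inj_image_eq_iff)
  ultimately show ?thesis
    using left_line_image right_line_image lines_eq_central by metis
qed

text \<open>For \<open>v \<noteq> 0\<close> this says that the image is left affine
  (\<open>left_line_affine_iff\<close>); the explicit form also names the image line.\<close>

definition pos :: "'a ^ 'n \<Rightarrow> 'a ^ 'n \<Rightarrow> bool" where
  "pos x v \<longleftrightarrow> F ` left.line x v = left.line (F x) (\<delta> x v)"

lemma left_line_affine_iff:
  assumes "v \<noteq> 0"
  shows "left_affine (F ` left.line x v) \<longleftrightarrow> pos x v"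
proof
  assume "left_affine (F ` left.line x v)"
  moreover have "pivot_dim (direction (F ` left.line x v)) = 1"
    using pivot_dim_image left.affine_line assms left.direction_line left.pivot_dim_line by metis
  moreover have "F x \<in> F ` left.line x v" "F (x + v) \<in> F ` left.line x v" "F x \<noteq> F (x + v)"
    using assms inj_F left.line_mem by (auto simp: inj_eq simp del: image_eqI intro!: imageI)
  ultimately show "pos x v" unfolding pos_def \<delta>_def using left.line_unique by metis
qed (simp add: pos_def left.affine_line)

lemma pos_line:
  assumes "v \<noteq> 0" "q \<in> left.line p v" "w = c *s v" "w \<noteq> 0"
  shows "pos p v \<longleftrightarrow> pos q w"
  using left_line_affine_iff assms left.line_eq by metis

end

section \<open>Anti-isomorphisms and the opposite ring\<close>

definition anti_iso :: "('a::ring_1 \<Rightarrow> 'b::ring_1) \<Rightarrow> bool" where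
  "anti_iso \<phi> \<longleftrightarrow> bij \<phi> \<and> (\<forall>x y. \<phi> (x + y) = \<phi> x + \<phi> y) \<and> (\<forall>x y. \<phi> (x * y) = \<phi> y * \<phi> x)"

lemma componentwise_comp: "componentwise \<phi> (componentwise \<psi> x) = componentwise (\<phi> \<circ> \<psi>) x"
  by (simp add: componentwise_def)

lemma bij_componentwise:
  assumes "bij \<phi>"
  shows "bij (componentwise \<phi>)"
proof (rule o_bij)
  have "\<phi> (inv \<phi> y) = y" "inv \<phi> (\<phi> x) = x" for x y
    using assms by (simp_all add: bij_is_surj surj_f_inv_f bij_is_inj)
  then show "componentwise (inv \<phi>) \<circ> componentwise \<phi> = id" "componentwise \<phi> \<circ> componentwise (inv \<phi>) = id"
    by (simp_all add: fun_eq_iff componentwise_def)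
qed

locale anti =
  fixes \<phi> :: "'a::division_ring \<Rightarrow> 'b::division_ring"
  assumes anti: "anti_iso \<phi>"
begin

lemma componentwise_add: "componentwise \<phi> (x + y) = componentwise \<phi> x + componentwise \<phi> y"
  and componentwise_left: "componentwise \<phi> (c *s x) = right_scale (\<phi> c) (componentwise \<phi> x)"
  and componentwise_right: "componentwise \<phi> (right_scale c x) = \<phi> c *s componentwise \<phi> x"
  and surj: "range \<phi> = UNIV"
  using anti by (simp_all add: componentwise_def vec_eq_iff right_scale_def anti_iso_def bij_def)

lemma componentwise_zero: "componentwise \<phi> 0 = 0"
  using componentwise_add[of 0 0] by simp

lemma image_translate:
  "componentwise \<phi> ` ((\<lambda>v. p + v) ` V) = (\<lambda>v. componentwise \<phi> p + v) ` componentwise \<phi> ` V"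
  by (simp add: image_image componentwise_add)

lemma sub_left:
  assumes "vsubspace (*s) V"
  shows "vsubspace right_scale (componentwise \<phi> ` V)"
  unfolding vsubspace_def
proof (intro conjI ballI allI)
  show "0 \<in> componentwise \<phi> ` V" using left.sub_zero[OF assms] componentwise_zero by (metis imageI)
  fix x assume x: "x \<in> componentwise \<phi> ` V"
  show "x + y \<in> componentwise \<phi> ` V" if "y \<in> componentwise \<phi> ` V" for y
    using that x left.sub_add[OF assms] by (auto simp: componentwise_add[symmetric])
  show "right_scale c x \<in> componentwise \<phi> ` V" for c
  proof -
    obtain d where "c = \<phi> d" using surj by (metis rangeE UNIV_I)
    then show ?thesis using x left.sub_scale[OF assms] by (auto simp: componentwise_left[symmetric])
  qed
qed

lemma sub_right:
  assumes "vsubspace right_scale V"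
  shows "vsubspace (*s) (componentwise \<phi> ` V)"
  unfolding vsubspace_def
proof (intro conjI ballI allI)
  show "0 \<in> componentwise \<phi> ` V" using right.sub_zero[OF assms] componentwise_zero by (metis imageI)
  fix x assume x: "x \<in> componentwise \<phi> ` V"
  show "x + y \<in> componentwise \<phi> ` V" if "y \<in> componentwise \<phi> ` V" for y
    using that x right.sub_add[OF assms] by (auto simp: componentwise_add[symmetric])
  show "c *s x \<in> componentwise \<phi> ` V" for c
  proof -
    obtain d where "c = \<phi> d" using surj by (metis rangeE UNIV_I)
    then show ?thesis using x right.sub_scale[OF assms] by (auto simp: componentwise_right[symmetric])
  qed
qed

lemma affine_left: "left_affine A \<Longrightarrow> right_affine (componentwise \<phi> ` A)"
  unfolding affine_subspace_def using image_translate sub_left by metis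

lemma affine_right: "right_affine A \<Longrightarrow> left_affine (componentwise \<phi> ` A)"
  unfolding affine_subspace_def using image_translate sub_right by metis

lemma line_left: "componentwise \<phi> ` left.line p v = right.line (componentwise \<phi> p) (componentwise \<phi> v)"
  unfolding left.line_range right.line_range surj[symmetric]
  by (simp add: componentwise_add componentwise_left image_image)

lemma line_right: "componentwise \<phi> ` right.line p v = left.line (componentwise \<phi> p) (componentwise \<phi> v)"
  unfolding left.line_range right.line_range surj[symmetric]
  by (simp add: componentwise_add componentwise_right image_image)

lemma inj_componentwise: "inj (componentwise \<phi> :: 'a ^ 'n \<Rightarrow> 'b ^ 'n)"
  by (rule bij_is_inj, rule bij_componentwise) (use anti in \<open>simp add: anti_iso_def\<close>)

text \<open>The map interchanges the left and the right line of a direction, so it preserves whether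
  they coincide.\<close>

lemma central_componentwise: "central_direction (componentwise \<phi> v) \<longleftrightarrow> central_direction (v :: 'a ^ 'n::finite)"
  using lines_eq_central[of 0 v] lines_eq_central[of "componentwise \<phi> 0" "componentwise \<phi> v"]
    line_left[of 0 v] line_right[of 0 v] inj_componentwise by (metis inj_image_eq_iff)

end

lemma lr_map_anti_comp:
  assumes "lr_map F" "anti_iso \<phi>"
  shows "lr_map (componentwise \<phi> \<circ> F)"
proof -
  interpret lr_map F by fact
  interpret anti \<phi> using assms(2) by unfold_locales
  show ?thesis
  proof
    show "inj (componentwise \<phi> \<circ> F)" using inj_componentwise inj_F by (rule inj_compose)
    show "left_affine ((componentwise \<phi> \<circ> F) ` A) \<or> right_affine ((componentwise \<phi> \<circ> F) ` A)"
      if "left_affine A \<or> right_affine A" for A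
      using lr[OF that] affine_left affine_right by (metis image_comp)
  qed
qed

lemma lr_map_comp_anti:
  assumes "lr_map F" "anti_iso \<phi>"
  shows "lr_map (F \<circ> componentwise \<phi>)"
proof -
  interpret lr_map F by fact
  interpret anti \<phi> using assms(2) by unfold_locales
  show ?thesis
  proof
    show "inj (F \<circ> componentwise \<phi>)" using inj_F inj_componentwise by (rule inj_compose)
    show "left_affine ((F \<circ> componentwise \<phi>) ` A) \<or> right_affine ((F \<circ> componentwise \<phi>) ` A)"
      if "left_affine A \<or> right_affine A" for A
      using lr that affine_left affine_right by (metis image_comp)
  qed
qed

text \<open>A ring anti-isomorphic to \<open>'a\<close> that is always at hand. Statements about
  right lines become statements about left lines over \<open>'a opp\<close>.\<close>

datatype 'a opp = Opp (unopp: 'a)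

instantiation opp :: (division_ring) division_ring
begin
definition "0 = Opp 0"
definition "1 = Opp 1"
definition "x + y = Opp (unopp x + unopp y)"
definition "x - y = Opp (unopp x - unopp y)"
definition "- x = Opp (- unopp x)"
definition "x * y = Opp (unopp y * unopp x)"
definition "inverse x = Opp (inverse (unopp x))"
definition divide_opp :: "'a opp \<Rightarrow> 'a opp \<Rightarrow> 'a opp" where "divide_opp x y = x * inverse y"
instance
  by standard
    (auto simp: zero_opp_def one_opp_def plus_opp_def minus_opp_def uminus_opp_def times_opp_def
      inverse_opp_def divide_opp_def algebra_simps intro: opp.expand,
      (metis opp.collapse left_inverse right_inverse)+)
end

lemma anti_iso_Opp: "anti_iso (Opp :: 'a::division_ring \<Rightarrow> 'a opp)"
  unfolding anti_iso_def bij_def inj_def surj_def plus_opp_def times_opp_def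
  by (auto intro: opp.exhaust_sel)

lemma anti_iso_unopp: "anti_iso (unopp :: 'a::division_ring opp \<Rightarrow> 'a)"
  unfolding anti_iso_def bij_def inj_def surj_def plus_opp_def times_opp_def
  by (auto intro: opp.expand) (metis opp.sel)

interpretation Opp: anti Opp by unfold_locales (rule anti_iso_Opp)
interpretation unopp: anti unopp by unfold_locales (rule anti_iso_unopp)

lemma componentwise_unopp_Opp: "componentwise unopp (componentwise Opp x) = x"
  by (simp add: componentwise_comp) (simp add: componentwise_def)

text \<open>The vectors of \<open>W\<close> whose right multiples all stay in \<open>W\<close> form
  a left subspace \<open>W'\<close>, because the two multiplications commute. It contains the right
  multiples of \<open>w\<close>, which do not fit into one left ray as \<open>w\<close> is not
  central; so \<open>W'\<close> has dimension 2 and is all of \<open>W\<close>. Consequently a left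
  plane that is not two-sided contains no purely right line.\<close>

lemma sub_right_closed:
  fixes W :: "('a::division_ring ^ 'n::finite) set"
  assumes W: "vsubspace (*s) W" "pivot_dim W \<le> 2"
    and w: "\<And>c. right_scale c w \<in> W" "\<not> central_direction w"
  shows "vsubspace right_scale W"
proof -
  define W' where "W' = {z \<in> W. \<forall>c. right_scale c z \<in> W}"
  have W': "vsubspace (*s) W'"
    unfolding vsubspace_def W'_def
    using left.sub_zero[OF W(1)] left.sub_add[OF W(1)] left.sub_scale[OF W(1)]
    by (auto simp: right.s_add left_right_scale[symmetric])
  have wW: "w \<in> W" using w(1)[of 1] by (simp add: right.s_one)
  have "right_scale d (right_scale c w) \<in> W" for c d using w right.s_s by metis
  then have rw: "right_scale c w \<in> W'" for c using w unfolding W'_def by blast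
  then have "w \<in> W'" using right.s_one by metis
  then have sub: "left.add_ray {0} w \<subseteq> W'"
    using W' by (intro left.add_ray_least) (auto simp: left.sub_zero)
  have "w \<noteq> 0" using w(2) central_directionI_right[of 0] by auto
  have "\<not> pivot_dim W' \<le> 1"
  proof
    assume "pivot_dim W' \<le> 1"
    then have "left.add_ray {0} w = W'"
      using W' left.pivot_dim_line[OF \<open>w \<noteq> 0\<close>]
      by (intro left.sub_eqI sub left.sub_add_ray left.sub_singleton_0) (auto intro: left.sub_diff)
    then show False using rw w(2) central_directionI_right left.mem_ray by metis
  qed
  then have "W' = W"
    using W W' by (intro left.sub_eqI) (auto simp: W'_def intro: left.sub_diff)
  then have "\<forall>z\<in>W. \<forall>c. right_scale c z \<in> W" unfolding W'_def by blast
  then show ?thesis unfolding vsubspace_def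
    using left.sub_zero[OF W(1)] left.sub_add[OF W(1)] by blast
qed

lemma pivot_dim_image_Opp: "pivot_dim (componentwise Opp ` W) = pivot_dim (W :: ('a::division_ring ^ 'n::finite) set)"
proof -
  have "lead (componentwise Opp x) i \<longleftrightarrow> lead x i" for x :: "'a ^ 'n" and i
    by (simp add: lead_def componentwise_def zero_opp_def)
  then show ?thesis by (simp add: pivot_dim_def pivots_def)
qed

lemma sub_left_closed:
  fixes W :: "('a::division_ring ^ 'n::finite) set"
  assumes W: "vsubspace right_scale W" "pivot_dim W \<le> 2"
    and w: "\<And>c. c *s w \<in> W" "\<not> central_direction w"
  shows "vsubspace (*s) W"
proof -
  have "right_scale c (componentwise Opp w) \<in> componentwise Opp ` W" for c
    using w(1)[of "unopp c"] Opp.componentwise_left[of "unopp c" w] by (metis imageI opp.collapse)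
  then have "vsubspace right_scale (componentwise Opp ` W)"
    using assms Opp.sub_right by (intro sub_right_closed) (auto simp: pivot_dim_image_Opp Opp.central_componentwise)
  then have "vsubspace (*s) (componentwise unopp ` componentwise Opp ` W)"
    by (rule unopp.sub_right)
  then show ?thesis by (simp add: image_image componentwise_unopp_Opp)
qed

lemma central_zero: "central_direction (0 :: 'a::division_ring ^ 'n::finite)"
  using central_directionI_right[of 0] by auto

context lr_map
begin

lemma pos_iff:
  assumes "\<not> central_direction v"
  shows "pos x v \<longleftrightarrow> F ` right.line x v = right.line (F x) (\<delta> x v)"
  using pure_lines_image[OF assms, of x] lines_eq_central unfolding pos_def by metis

text \<open>The image is never two-sided: it would contain both lines over every noncentral
  direction of \<open>V\<close>, and pulling them back would close \<open>V\<close> under right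
  multiples. So the image has exactly one type, and a noncentral line of the other type inside it
  would make it two-sided by \<open>sub_right_closed\<close> or
  \<open>sub_left_closed\<close>.\<close>

lemma plane_pos_iff:
  assumes V: "vsubspace (*s) V" "pivot_dim V = 2" "\<not> vsubspace right_scale V"
    and p: "p - x \<in> V" and v: "v \<in> V" "\<not> central_direction v"
  shows "pos p v \<longleftrightarrow> left_affine (F ` (\<lambda>v. x + v) ` V)"
    and "left_affine (F ` (\<lambda>v. x + v) ` V) \<Longrightarrow> \<not> right_affine (F ` (\<lambda>v. x + v) ` V)"
proof -
  define A where "A = (\<lambda>v. x + v) ` V"
  have A: "left_affine A" unfolding A_def by (rule left.affine_translate[OF V(1)])
  have dA: "direction A = V" unfolding A_def by (rule left.direction_translate_sub[OF V(1)])
  have pivot_dim: "pivot_dim (direction (F ` A)) = 2" using pivot_dim_image A dA V(2) by simp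
  have lrA: "left_affine (F ` A) \<or> right_affine (F ` A)" using lr A by blast
  have sub: "left.line q u \<subseteq> A" if "q \<in> A" "u \<in> V" for q u
    using that A dA left.line_subset by blast
  have pA: "p \<in> A" unfolding A_def using p by (metis add_diff_cancel_left' diff_add_cancel image_eqI add.commute)
  have dir: "\<delta> q u \<in> direction (F ` A)" if "q \<in> A" "u \<in> V" for q u
    unfolding \<delta>_def using sub[OF that] left.line_mem[of q u] that by (intro direction_memI) auto
  have pure: "\<not> (left_affine (F ` A) \<and> right_affine (F ` A))"
  proof
    assume *: "left_affine (F ` A) \<and> right_affine (F ` A)"
    obtain u c where u: "u \<in> V" "right_scale c u \<notin> V"
      using V unfolding vsubspace_def by blast
    then have nc: "\<not> central_direction u"
      using central_directionD_right left.sub_scale[OF V(1)] by metis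
    have "left.line (F p) (\<delta> p u) \<subseteq> F ` A" "right.line (F p) (\<delta> p u) \<subseteq> F ` A"
      using * pA dir[OF pA u(1)] left.line_subset right.line_subset by blast+
    then have "F ` right.line p u \<subseteq> F ` A" using pure_lines_image[OF nc] by metis
    then have "right.line p u \<subseteq> A" using inj_F by (simp add: inj_image_subset_iff)
    then have "p + right_scale c u \<in> A" unfolding right.line_def by blast
    then show False using u left.affine_mem_iff[OF A pA] dA by simp
  qed
  then show "left_affine (F ` (\<lambda>v. x + v) ` V) \<Longrightarrow> \<not> right_affine (F ` (\<lambda>v. x + v) ` V)"
    unfolding A_def by blast
  have img: "F ` left.line p v \<subseteq> F ` A" using sub[OF pA v(1)] by blast
  have Fp: "F p \<in> F ` A" using pA by blast
  have nd: "\<not> central_direction (\<delta> p v)" using pure_lines_image[OF v(2)] by blast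
  show "pos p v \<longleftrightarrow> left_affine (F ` (\<lambda>v. x + v) ` V)"
    unfolding A_def[symmetric]
  proof
    assume pos: "pos p v"
    show "left_affine (F ` A)"
    proof (rule ccontr)
      assume "\<not> ?thesis"
      then have r: "right_affine (F ` A)" using lrA by blast
      have "c *s \<delta> p v \<in> direction (F ` A)" for c
      proof -
        have "F p + c *s \<delta> p v \<in> F ` A"
          using pos img unfolding pos_def left.line_def by blast
        then show ?thesis using right.affine_mem_iff[OF r Fp] by simp
      qed
      then have "vsubspace (*s) (direction (F ` A))"
        using pivot_dim nd r by (intro sub_left_closed right.sub_direction) auto
      then have "left_affine (F ` A)"
        using left.affine_translate right.affine_eq_translate[OF r Fp] by metis
      with \<open>\<not> ?thesis\<close> show False by blast
    qed
  next
    assume l: "left_affine (F ` A)"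
    show "pos p v"
    proof (rule ccontr)
      assume "\<not> ?thesis"
      then have *: "F ` left.line p v = right.line (F p) (\<delta> p v)"
        using pure_lines_image[OF v(2)] unfolding pos_def by blast
      have "right_scale c (\<delta> p v) \<in> direction (F ` A)" for c
      proof -
        have "F p + right_scale c (\<delta> p v) \<in> F ` A"
          using * img unfolding right.line_def by blast
        then show ?thesis using left.affine_mem_iff[OF l Fp] by simp
      qed
      then have "vsubspace right_scale (direction (F ` A))"
        using pivot_dim nd l by (intro sub_right_closed left.sub_direction) auto
      then have "right_affine (F ` A)"
        using right.affine_translate left.affine_eq_translate[OF l Fp] by metis
      with l pure show False by blast
    qed
  qed
qed

end

section \<open>Types of lines\<close>

lemma vec_eq_sum_axis: "x = (\<Sum>i\<in>UNIV. x $ i *s axis i 1)"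
  for x :: "'a::division_ring ^ 'n::finite"
  by (simp add: vec_eq_iff axis_def if_distrib cong: if_cong)

lemma left_UNIV_I:
  assumes "vsubspace (*s) (W :: ('a::division_ring ^ 'n::finite) set)" "\<And>i. axis i 1 \<in> W"
  shows "W = UNIV"
proof -
  have "x \<in> W" for x
    using left.sub_sum[OF assms(1), of UNIV "\<lambda>i. x $ i *s axis i 1"] left.sub_scale[OF assms(1)] assms(2)
      vec_eq_sum_axis[of x]
    by metis
  then show ?thesis by blast
qed

section \<open>Planes spanned by two directions, and tilting\<close>

abbreviation left_span2 :: "'a::division_ring ^ 'n::finite \<Rightarrow> 'a ^ 'n \<Rightarrow> ('a ^ 'n) set" where
  "left_span2 u v \<equiv> left.add_ray (left.add_ray {0} u) v"

lemma sub_left_span2: "vsubspace (*s) (left_span2 u v)"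
  by (intro left.sub_add_ray left.sub_singleton_0)

lemma mem_left_span2: "x \<in> left_span2 u v \<longleftrightarrow> (\<exists>a b. x = a *s u + b *s v)"
  by (auto simp: left.add_ray_def[of _ v] left.mem_ray)

lemma left_span2_zero [simp]: "0 \<in> left_span2 u v"
  by (rule left.sub_zero[OF sub_left_span2])

lemma left_span2_mem [simp]: "u \<in> left_span2 u v" "v \<in> left_span2 u v"
  using left.add_ray_mem[OF left.sub_add_ray[OF left.sub_singleton_0]] left.add_ray_mem[OF left.sub_singleton_0]
    left.add_ray_supset by blast+

lemma pivot_dim_left_span2:
  assumes "u \<noteq> 0" "v \<notin> left.add_ray {0} u"
  shows "pivot_dim (left_span2 u v) = 2"
  using left.pivot_dim_add_ray[OF left.sub_add_ray[OF left.sub_singleton_0] assms(2)] left.pivot_dim_line[OF assms(1)] by simp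

text \<open>The tilted span meets \<open>W\<close> only in the left ray of \<open>v\<close>. Right
  multiples of \<open>v\<close> lie in \<open>W\<close>; if they also lay in the span, they would be
  left multiples of \<open>v\<close>, which is not central.\<close>

lemma left_span2_not_right:
  assumes W: "vsubspace (*s) W" "vsubspace right_scale W"
    and v: "v \<in> W" "\<not> central_direction v" and g: "g \<in> W" and e: "e \<notin> W"
  shows "pivot_dim (left_span2 v (g + e)) = 2" "\<not> vsubspace right_scale (left_span2 v (g + e))"
proof -
  have "v \<noteq> 0" using v central_zero by blast
  have geW: "g + e \<notin> W" using g e left.sub_diff[OF W(1), of "g + e" g] by auto
  then have "g + e \<notin> left.add_ray {0} v" using v left.sub_scale[OF W(1)] by (auto simp: left.mem_ray)
  then show "pivot_dim (left_span2 v (g + e)) = 2" using \<open>v \<noteq> 0\<close> by (intro pivot_dim_left_span2)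
  show "\<not> vsubspace right_scale (left_span2 v (g + e))"
  proof
    assume r: "vsubspace right_scale (left_span2 v (g + e))"
    have "\<exists>a. right_scale d v = a *s v" for d
    proof -
      have "right_scale d v \<in> left_span2 v (g + e)" using right.sub_scale[OF r left_span2_mem(1)] .
      then obtain a b where ab: "right_scale d v = a *s v + b *s (g + e)"
        using mem_left_span2 by blast
      have "b *s (g + e) = right_scale d v - a *s v" using ab by simp
      also have "\<dots> \<in> W" using v W left.sub_diff left.sub_scale right.sub_scale by metis
      finally have "b = 0" using geW left.sub_scale_iff[OF W(1)] by blast
      then show ?thesis using ab by auto
    qed
    then show False using v(2) central_directionI_right by blast
  qed
qed

lemma central_axis: "right_scale d (axis i 1) = d *s (axis i 1 :: 'a::division_ring ^ 'n::finite)"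
  by (simp add: vec_eq_iff right_scale_def axis_def)

text \<open>The axis vector commutes with scalars. If right multiplication of the sum by
  \<open>d\<close> equals left multiplication by \<open>c\<close>, reduction modulo \<open>W\<close>
  gives \<open>c = d\<close>, and what remains is that \<open>u\<close> itself is central.\<close>

lemma not_central_add_axis:
  fixes u :: "'a::division_ring ^ 'n::finite"
  assumes W: "vsubspace (*s) W" "vsubspace right_scale W"
    and u: "u \<in> W" "\<not> central_direction u" and e: "axis i 1 \<notin> W"
  shows "\<not> central_direction (u + axis i 1)"
proof
  assume *: "central_direction (u + axis i 1)"
  have "\<exists>c. right_scale d u = c *s u" for d
  proof -
    obtain c where "right_scale d (u + axis i 1) = c *s (u + axis i 1)"
      using central_directionD_right[OF *] by blast
    then have "right_scale d u - c *s u = c *s axis i 1 - d *s axis i 1"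
      by (simp add: right.s_add left.s_add central_axis algebra_simps)
    also have "\<dots> = (c - d) *s axis i 1" by (simp add: vec_eq_iff algebra_simps)
    finally have eq: "(c - d) *s axis i 1 = right_scale d u - c *s u" by simp
    have "right_scale d u - c *s u \<in> W"
      using u W left.sub_diff left.sub_scale right.sub_scale by metis
    then have "c - d = 0" using eq e left.sub_scale_iff[OF W(1)] by metis
    then show ?thesis using eq by auto
  qed
  then show False using u(2) central_directionI_right by blast
qed

text \<open>The type-keeping case. Two-sided lines are left out; their images are deduced afterwards
  from those of the other lines.\<close>

definition pure_pos :: "('a::division_ring ^ 'n::finite \<Rightarrow> 'b::division_ring ^ 'n) \<Rightarrow> bool" where
  "pure_pos F \<longleftrightarrow> (\<forall>x v. \<not> central_direction v \<longrightarrow> left_affine (F ` left.line x v))"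

context lr_map
begin

lemma plane_pos_const:
  assumes V: "vsubspace (*s) V" "pivot_dim V = 2" "\<not> vsubspace right_scale V"
    and "q - p \<in> V" "u \<in> V" "\<not> central_direction u" "v \<in> V" "\<not> central_direction v"
  shows "pos p u \<longleftrightarrow> pos q v"
  using plane_pos_iff(1)[OF V, of p p u] plane_pos_iff(1)[OF V, of q p v] assms left.sub_zero[OF V(1)]
  by simp

lemma axis_outside:
  assumes "CARD('n) \<ge> 3" "vsubspace (*s) (W :: ('a ^ 'n) set)" "pivot_dim W \<le> 2"
  obtains i where "axis i 1 \<notin> W"
proof (rule ccontr)
  assume "\<not> thesis"
  then have "W = UNIV" using left_UNIV_I[OF assms(2)] that by blast
  then have "pivot_dim W = CARD('n)" using pivot_dim_UNIV by metis
  then show False using assms by simp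
qed

text \<open>One plane suffices unless the span of \<open>u\<close> and \<open>v\<close> is
  two-sided. In that case \<open>u + e\<close>, with an axis vector \<open>e\<close> outside, is a
  noncentral link: it shares the tilted plane of \<open>u\<close> and \<open>e\<close> with
  \<open>u\<close>, and that of \<open>v\<close> and \<open>u + e\<close> with
  \<open>v\<close>.\<close>

lemma pos_const_direction:
  assumes n: "CARD('n) \<ge> 3" and u: "\<not> central_direction u" and v: "\<not> central_direction v"
  shows "pos p u \<longleftrightarrow> pos p v"
proof (cases "v \<in> left.add_ray {0} u")
  case True
  then show ?thesis using pos_line[OF _ left.line_mem(1)] u v central_zero left.mem_ray by metis
next
  case False
  let ?W = "left_span2 u v"
  have "u \<noteq> 0" using u central_zero by blast
  then have pivot_dim: "pivot_dim ?W = 2" using False pivot_dim_left_span2 by blast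
  show ?thesis
  proof (cases "vsubspace right_scale ?W")
    case False
    show ?thesis
      using plane_pos_const[OF sub_left_span2 pivot_dim False, of p p] u v left_span2_mem[where u = u and v = v] by simp
  next
    case True
    obtain i where i: "axis i 1 \<notin> ?W" using axis_outside[OF n sub_left_span2] pivot_dim by (metis order_refl)
    let ?e = "axis i 1"
    note sp = left_span2_not_right[OF sub_left_span2 True _ _ _ i]
    have ue: "\<not> central_direction (u + ?e)"
      by (intro not_central_add_axis[OF sub_left_span2 True _ u i] left_span2_mem)
    have "u + ?e \<in> left_span2 u (0 + ?e)"
      using left.sub_add[OF sub_left_span2 left_span2_mem, of u ?e] by simp
    then have "pos p u \<longleftrightarrow> pos p (u + ?e)"
      using sp[of u 0] u ue
      by (intro plane_pos_const[where V = "left_span2 u (0 + ?e)"] sub_left_span2) auto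
    moreover have "pos p v \<longleftrightarrow> pos p (u + ?e)"
      using sp[of v u] v u ue
      by (intro plane_pos_const[where V = "left_span2 v (u + ?e)"] sub_left_span2) auto
    ultimately show ?thesis by blast
  qed
qed

text \<open>If the plane of \<open>v\<close> and \<open>q - p\<close> is two-sided, the way from
  \<open>p\<close> to \<open>q\<close> leads over \<open>p + e\<close> with an axis vector
  \<open>e\<close> outside; each leg together with \<open>v\<close> spans a tilted plane.\<close>

lemma pos_const_translate:
  assumes n: "CARD('n) \<ge> 3" and v: "\<not> central_direction v"
  shows "pos p v \<longleftrightarrow> pos q v"
proof (cases "q - p \<in> left.add_ray {0} v")
  case True
  then obtain c where "q = p + c *s v" using left.mem_ray by (metis add.commute diff_add_cancel)
  then have "q \<in> left.line p v" unfolding left.line_def by blast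
  then show ?thesis using pos_line[where c = 1] v central_zero left.s_one by metis
next
  case False
  let ?t = "q - p" let ?W = "left_span2 v ?t"
  have "v \<noteq> 0" using v central_zero by blast
  then have pivot_dim: "pivot_dim ?W = 2" using False pivot_dim_left_span2 by blast
  show ?thesis
  proof (cases "vsubspace right_scale ?W")
    case False
    show ?thesis
      using plane_pos_const[OF sub_left_span2 pivot_dim False, of q p] v left_span2_mem[where u = v and v = ?t] by simp
  next
    case True
    obtain i where i: "axis i 1 \<notin> ?W" using axis_outside[OF n sub_left_span2] pivot_dim by (metis order_refl)
    let ?e = "axis i 1"
    have i': "- ?e \<notin> ?W" using i left.sub_uminus[OF sub_left_span2] by force
    have "pos p v \<longleftrightarrow> pos (p + ?e) v"
      using left_span2_not_right[OF sub_left_span2 True _ v _ i, of 0] v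
      by (intro plane_pos_const[where V = "left_span2 v (0 + ?e)"] sub_left_span2) auto
    moreover have "q - (p + ?e) \<in> left_span2 v (?t + - ?e)"
      using left_span2_mem(2)[of "?t + - ?e" v] by (simp add: algebra_simps)
    then have "pos (p + ?e) v \<longleftrightarrow> pos q v"
      using left_span2_not_right[OF sub_left_span2 True _ v _ i', of ?t] v left_span2_mem
      by (intro plane_pos_const[where V = "left_span2 v (?t + - ?e)"] sub_left_span2) auto
    ultimately show ?thesis by blast
  qed
qed

lemma pos_const:
  assumes "CARD('n) \<ge> 3" "\<not> central_direction u" "\<not> central_direction v"
  shows "pos p u \<longleftrightarrow> pos q v"
  using pos_const_direction[OF assms] pos_const_translate assms by blast

lemma pure_pos_iff: "pure_pos F \<longleftrightarrow> (\<forall>x v. \<not> central_direction v \<longrightarrow> pos x v)"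
  unfolding pure_pos_def using left_line_affine_iff central_zero by metis

lemma pure_posI:
  assumes "CARD('n) \<ge> 3" "\<not> central_direction u" "left_affine (F ` left.line p u)"
  shows "pure_pos F"
  using assms pos_const pure_pos_iff left_line_affine_iff central_zero by metis

text \<open>The idea is to put the line into a left plane that is not two-sided and contains a
  noncentral \<open>v\<close>. By \<open>pure_pos\<close> the image of this plane is left and not
  right, so by \<open>sub_right_closed\<close> it has no room for a purely right line.\<close>

lemma central_line_left_ge3:
  fixes a d :: 'a
  assumes n: "CARD('n) \<ge> 3" and ad: "a * d \<noteq> d * a" and pure: "pure_pos F"
    and t: "t \<noteq> 0"
  shows "left_affine (F ` left.line x t)"
proof -
  obtain i where i: "t $ i \<noteq> 0" using t by (auto simp: vec_eq_iff)
  obtain j k where jk: "j \<noteq> i" "k \<noteq> i" "j \<noteq> k"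
  proof -
    have "card (UNIV - {i}) \<ge> 2" using n by (simp add: card_Diff_singleton)
    then obtain j where j: "j \<in> UNIV - {i}"
      by (metis card.empty equals0I not_numeral_le_zero)
    then have "card (UNIV - {i} - {j}) \<ge> 1" using n by (simp add: card_Diff_singleton)
    then obtain k where "k \<in> UNIV - {i} - {j}"
      by (metis card.empty equals0I not_one_le_zero)
    then show thesis using j that by blast
  qed
  \<comment> \<open>At \<open>i\<close> this vanishes while \<open>t\<close> does not, so a right
    multiple of \<open>v\<close> in the plane must be a left multiple of \<open>v\<close>; the
    entries 1 and \<open>a\<close> then force \<open>d\<close> to commute with
    \<open>a\<close>.\<close>
  define v :: "'a ^ 'n" where "v = axis j 1 + a *s axis k 1"
  have vc: "v $ i = 0" "v $ j = 1" "v $ k = a" using jk by (simp_all add: v_def axis_def)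
  let ?V = "left_span2 t v"
  have "v \<notin> left.add_ray {0} t" using vc i by (auto simp: left.mem_ray)
  then have pivot_dim: "pivot_dim ?V = 2" using t by (intro pivot_dim_left_span2)
  have "right_scale d v \<notin> ?V"
  proof
    assume "right_scale d v \<in> ?V"
    then obtain \<alpha> \<beta> where ab: "right_scale d v = \<alpha> *s t + \<beta> *s v" using mem_left_span2 by blast
    have c: "v $ l * d = \<alpha> * t $ l + \<beta> * v $ l" for l
      using arg_cong[OF ab, of "\<lambda>x. x $ l"] by (simp add: right_scale_def)
    have "\<alpha> = 0" using c[of i] i vc by simp
    then show False using c[of j] c[of k] vc ad by simp
  qed
  then have nr: "\<not> vsubspace right_scale ?V" using right.sub_scale left_span2_mem(2) by blast
  have nv: "\<not> central_direction v"
    using central_directionD_right left.sub_scale[OF sub_left_span2 left_span2_mem(2)] \<open>right_scale d v \<notin> ?V\<close>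
    by metis
  let ?A = "(\<lambda>v. x + v) ` ?V"
  have "pos x v" using pure nv pure_pos_iff by blast
  then have lA: "left_affine (F ` ?A)"
    using plane_pos_iff(1)[OF sub_left_span2 pivot_dim nr, of x x v] nv by simp
  then have nrA: "\<not> right_affine (F ` ?A)"
    using plane_pos_iff(2)[OF sub_left_span2 pivot_dim nr, of x x v] nv by simp
  have A: "left_affine ?A" "direction ?A = ?V"
    by (simp_all add: left.affine_translate sub_left_span2 left.direction_translate_sub)
  have xA: "x \<in> ?A" using left_span2_zero[of t v] by force
  then have sub: "F ` left.line x t \<subseteq> F ` ?A"
    using A left_span2_mem by (intro image_mono left.line_subset) auto
  show ?thesis
  proof (rule ccontr)
    assume "\<not> ?thesis"
    then have r: "F ` left.line x t = right.line (F x) (\<delta> x t)" "\<not> central_direction (\<delta> x t)"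
      using left_line_image[OF t] left.affine_line lines_eq_central by metis+
    have Fx: "F x \<in> F ` ?A" using xA by (rule imageI)
    have "right_scale c (\<delta> x t) \<in> direction (F ` ?A)" for c
    proof -
      have "F x + right_scale c (\<delta> x t) \<in> F ` left.line x t"
        unfolding r(1) right.line_def by blast
      then have "F x + right_scale c (\<delta> x t) \<in> F ` ?A" using sub by (rule subsetD[rotated])
      then show ?thesis using left.affine_mem_iff[OF lA Fx] by simp
    qed
    then have "vsubspace right_scale (direction (F ` ?A))"
      using r pivot_dim_image[of ?A] A lA pivot_dim by (intro sub_right_closed left.sub_direction) auto
    then show False using nrA right.affine_translate left.affine_eq_translate[OF lA Fx] by metis
  qed
qed

end

lemma disjoint_left_lines_parallel:
  fixes v v' :: "'a::division_ring ^ 'n::finite"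
  assumes n: "CARD('n) = 2" and "v \<noteq> 0" "left.line p v \<inter> left.line p' v' = {}"
  shows "v' \<in> left.add_ray {0} v"
proof (rule ccontr)
  assume "v' \<notin> left.add_ray {0} v"
  then have "left_span2 v v' = UNIV"
    using pivot_dim_left_span2[of v v'] assms pivot_dim_UNIV[where 'a = 'a and 'n = 'n]
    by (intro left.sub_eqI sub_left_span2) auto
  then obtain a b where "p' - p = a *s v + b *s v'" using mem_left_span2[of "p' - p" v v'] by auto
  then have "p + a *s v = p' + (- b) *s v'" by (simp add: algebra_simps vec_eq_iff)
  moreover have "p + a *s v \<in> left.line p v" "p' + (- b) *s v' \<in> left.line p' v'"
    unfolding left.line_def by blast+
  ultimately show False using assms(3) by auto
qed

text \<open>Write \<open>v = d *s z\<close> and let right multiplication of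
  \<open>v + c *s t\<close> by \<open>a\<close> be left multiplication by \<open>e\<close>.
  Comparing the parts along \<open>t\<close> and \<open>z\<close> gives \<open>c * a = e * c\<close>
  and \<open>d * a = e * d\<close>. So conjugation by \<open>c\<close> and by \<open>d\<close>
  agree, and \<open>inverse c * d\<close> is central and can be absorbed into
  \<open>z\<close>.\<close>

lemma central_sum_scale:
  fixes t :: "'a::division_ring ^ 'n::finite"
  assumes v: "central_direction v" and vw: "central_direction (v + c *s t)"
    and t: "\<forall>i. t $ i \<in> centre" and "c \<noteq> 0" "t \<notin> left.add_ray {0} v"
  shows "\<exists>z. v = c *s z \<and> (\<forall>i. z $ i \<in> centre)"
proof -
  obtain d z where z: "v = d *s z" "\<forall>i. z $ i \<in> centre" using v unfolding central_direction_def by blast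
  define k where "k = inverse c * d"
  have "k * a = a * k" if "v \<noteq> 0" for a
  proof -
    obtain e where e: "right_scale a (v + c *s t) = e *s (v + c *s t)"
      using central_directionD_right[OF vw] by blast
    have "(d * a) *s z + (c * a) *s t = right_scale a (v + c *s t)"
      using z t by (simp add: vec_eq_iff right_scale_def algebra_simps central_commute)
    also have "\<dots> = (e * d) *s z + (e * c) *s t"
      by (subst e) (simp add: z(1) vec_eq_iff algebra_simps)
    finally have eq: "(c * a - e * c) *s t = (e * d - d * a) *s z"
      by (simp add: vec_eq_iff algebra_simps)
    have "d \<noteq> 0" "z \<noteq> 0" using z that by auto
    have "c * a = e * c"
    proof (rule ccontr)
      assume "c * a \<noteq> e * c"
      then have "t = inverse (c * a - e * c) *s ((c * a - e * c) *s t)"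
        by (simp add: vec_eq_iff mult.assoc[symmetric])
      also have "\<dots> = (inverse (c * a - e * c) * (e * d - d * a) * inverse d) *s v"
        unfolding eq z(1) using \<open>d \<noteq> 0\<close> by (simp add: vec_eq_iff mult.assoc) (simp add: mult.assoc[symmetric])
      finally show False using assms left.mem_ray by blast
    qed
    moreover then have "(e * d - d * a) *s z = 0" using eq by simp
    then have "e * d = d * a" using \<open>z \<noteq> 0\<close> left.s_coord[of "e * d - d * a" z] by (auto simp: vec_eq_iff)
    ultimately have "e = c * a * inverse c" "d * a = e * d" using \<open>c \<noteq> 0\<close> by (simp_all add: mult.assoc)
    then show ?thesis using \<open>c \<noteq> 0\<close> by (simp add: k_def mult.assoc) (simp add: mult.assoc[symmetric])
  qed
  then have "v \<noteq> 0 \<Longrightarrow> k \<in> centre" by (simp add: centre_def)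
  show ?thesis
  proof (cases "v = 0")
    case True
    then show ?thesis by (intro exI[of _ 0]) (simp add: centre_def)
  next
    case False
    then have "k \<in> centre" by fact
    then have "\<forall>i. (k *s z) $ i \<in> centre" using z(2) by (simp add: centre_mult)
    moreover have "v = c *s (k *s z)" using z \<open>c \<noteq> 0\<close>
      by (simp add: k_def vec_eq_iff mult.assoc[symmetric])
    ultimately show ?thesis by blast
  qed
qed

section \<open>Lines with central direction\<close>

context lr_map
begin

text \<open>Suppose that the line \<open>T\<close> through \<open>x\<close> with direction \<open>t = c *s t0\<close>, \<open>t0\<close> central, goes to a
  purely right line.  The preimage \<open>Y\<close> of the left line \<open>l\<close> through the images of \<open>x\<close> and \<open>x + t\<close> lies
  in \<open>x + c Z\<^sup>2\<close>, with \<open>Z\<close> the centre.  Some point \<open>q\<close> lies on two left lines that avoid this set; both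
  go to the parallel of \<open>l\<close> through the image of \<open>q\<close>, a contradiction.\<close>

lemma central_line_left_2:
  fixes b m :: 'a
  assumes n: "CARD('n) = 2" and bm: "b * m \<noteq> m * b" and pure: "pure_pos F"
    and t: "central_direction t" "t \<noteq> 0"
  shows "left_affine (F ` left.line x t)"
proof (rule ccontr)
  assume neg: "\<not> ?thesis"
  define u w where "u = F x" and "w = \<delta> x t"
  define T where "T = left.line x t"
  define l where "l = left.line u w"
  define Y where "Y = F -` l"
  have FT: "F ` T = right.line u w"
    using neg left_line_image[OF t(2)] left.affine_line unfolding T_def u_def w_def by metis
  have w: "\<not> central_direction w"
    using neg FT lines_eq_central left.affine_line unfolding T_def by metis
  have "w \<noteq> 0" using w central_zero by blast
  have "x \<in> T" "x + t \<in> T" unfolding T_def by (rule left.line_mem)+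
  have "x \<in> Y" "x + t \<in> Y"
    using left.line_mem[of u w] unfolding Y_def l_def u_def w_def \<delta>_def by auto
  have l: "left.line p (q - p) = l" if "p \<in> l" "q \<in> l" "p \<noteq> q" for p q
    using that unfolding l_def by (rule left.line_through)
  have T: "left.line p (q - p) = T" if "p \<in> T" "q \<in> T" "p \<noteq> q" for p q
    using that unfolding T_def by (rule left.line_through)

  \<comment> \<open>Otherwise the left line through \<open>p\<close> and \<open>z\<close> would map onto \<open>l\<close> and hence contain \<open>q\<close>.\<close>
  have central: "central_direction (z - p)"
    if "z \<in> Y" "z \<notin> T" and p: "p \<in> Y" "p \<in> T" and q: "q \<in> Y" "q \<in> T" "p \<noteq> q" for z p q
  proof (rule ccontr)
    assume nc: "\<not> central_direction (z - p)"
    have "F ` left.line p (z - p) = left.line (F p) (F z - F p)"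
      using pure nc unfolding pure_pos_iff pos_def \<delta>_def by simp
    also have "\<dots> = l"
      using that inj_F by (intro l) (auto simp: Y_def inj_eq)
    finally have "q \<in> left.line p (z - p)" using q(1) inj_F unfolding Y_def
      by (metis inj_image_mem_iff vimageD)
    then have "left.line p (q - p) = left.line p (z - p)"
      using q(3) by (intro left.line_through left.line_mem)
    then have "z \<in> T" using T[OF p(2) q(2,3)] left.line_mem(2)[of p "z - p"] by simp
    then show False using that by blast
  qed

  obtain c t0 where t0: "t = c *s t0" "\<forall>i. t0 $ i \<in> centre"
    using t unfolding central_direction_def by blast
  have "c \<noteq> 0" "t0 \<noteq> 0" using t t0 by auto
  have xt: "x \<noteq> x + t" using t by simp
  have mem_T: "z \<in> T" if v: "v \<in> left.add_ray {0} (z - x)" "v \<noteq> 0" "v \<in> left.add_ray {0} t" for z v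
  proof -
    obtain \<alpha> \<beta> where "v = \<alpha> *s (z - x)" "v = \<beta> *s t" using v(1,3) unfolding left.mem_ray by blast
    then have "\<alpha> \<noteq> 0" "\<alpha> *s (z - x) \<in> left.add_ray {0} t" using v by auto
    then have "z - x \<in> left.add_ray {0} t"
      using left.sub_scale_iff[OF left.sub_add_ray[OF left.sub_singleton_0]] by blast
    then show ?thesis unfolding T_def
      using left.affine_mem_iff[OF left.affine_line left.line_mem(1)] left.direction_line by metis
  qed
  \<comment> \<open>Both \<open>x\<close> and \<open>x + t\<close> lie in \<open>Y\<close> and
    \<open>T\<close>, so \<open>z - x\<close> and \<open>z - x - t\<close> are central directions;
    their difference \<open>c *s t0\<close> fixes the left factor \<open>c\<close>, the same for all
    \<open>z\<close>.\<close>
  have outside: "\<exists>z0. z - x = c *s z0 \<and> (\<forall>i. z0 $ i \<in> centre)" if z: "z \<in> Y" "z \<notin> T" for z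
  proof (rule central_sum_scale)
    show "central_direction (z - x)" using central[OF z] \<open>x \<in> T\<close> \<open>x \<in> Y\<close> \<open>x + t \<in> T\<close> \<open>x + t \<in> Y\<close> xt by blast
    have "central_direction (z - (x + t))" using central[OF z] \<open>x \<in> T\<close> \<open>x \<in> Y\<close> \<open>x + t \<in> T\<close> \<open>x + t \<in> Y\<close> xt by metis
    moreover have "z - (x + t) = z - x + c *s (- t0)" using t0 by (simp add: vec_eq_iff)
    ultimately show "central_direction (z - x + c *s (- t0))" by simp
    show "\<forall>i. (- t0) $ i \<in> centre" using t0 by (simp add: centre_def)
    show "c \<noteq> 0" by fact
    have "t0 = inverse c *s t" using t0 \<open>c \<noteq> 0\<close> by (simp add: vec_eq_iff mult.assoc[symmetric])
    then have "t0 \<in> left.add_ray {0} t" using left.mem_ray by blast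
    then have "- t0 \<in> left.add_ray {0} t" by (rule left.sub_uminus[OF left.sub_add_ray[OF left.sub_singleton_0]])
    then show "- t0 \<notin> left.add_ray {0} (z - x)" using mem_T[of "- t0" z] z \<open>t0 \<noteq> 0\<close> by auto
  qed
  \<comment> \<open>For points of \<open>T\<close> the vector \<open>t\<close> is not independent,
    so a point of \<open>Y\<close> off \<open>T\<close> has to take its place. It exists because
    \<open>w\<close> is not central, so \<open>l\<close> is not contained in the right line that is
    the image of \<open>T\<close>.\<close>
  obtain z1 where z1: "z1 \<in> Y" "z1 \<notin> T"
  proof -
    have "\<not> l \<subseteq> right.line u w"
    proof
      assume *: "l \<subseteq> right.line u w"
      have "pivot_dim (direction l) = pivot_dim (direction (right.line u w))"
        unfolding l_def using \<open>w \<noteq> 0\<close>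
        by (simp add: left.direction_line right.direction_line left.pivot_dim_line right.pivot_dim_line)
      then have "l = right.line u w"
        using affine_strict_mono[of l "right.line u w"] * left.affine_line right.affine_line
        unfolding l_def by (metis less_irrefl psubsetI)
      then show False using w lines_eq_central unfolding l_def by blast
    qed
    then obtain y where "y \<in> l" "y \<notin> F ` T" using FT by blast
    then show thesis using that[of "inv F y"] bij_F unfolding Y_def
      by (metis bij_inv_eq_iff imageI vimageI)
  qed
  obtain z0 where z0: "z1 - x = c *s z0" "\<forall>i. z0 $ i \<in> centre" using outside[OF z1] by blast
  \<comment> \<open>Here \<open>z1 - z\<close> is \<open>x - z\<close> plus \<open>c *s z0\<close>,
    and \<open>z0\<close> carries the same factor \<open>c\<close>.\<close>
  have inside: "\<exists>z'. z - x = c *s z' \<and> (\<forall>i. z' $ i \<in> centre)" if z: "z \<in> Y" "z \<in> T" "z \<noteq> x" for z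
  proof -
    have zt: "z - x \<in> left.add_ray {0} t" using z unfolding T_def
      using left.affine_mem_iff[OF left.affine_line left.line_mem(1)] left.direction_line by metis
    have sub: "vsubspace (*s) (left.add_ray {0} t)" by (rule left.sub_add_ray[OF left.sub_singleton_0])
    have "\<exists>z'. x - z = c *s z' \<and> (\<forall>i. z' $ i \<in> centre)"
    proof (rule central_sum_scale)
      obtain d where "x - z = d *s t" using left.sub_uminus[OF sub zt] left.mem_ray by auto
      then have "x - z = (d * c) *s t0" using t0 by (simp add: vec_eq_iff mult.assoc)
      then show "central_direction (x - z)" using t0 unfolding central_direction_def by blast
      have "x - z + c *s z0 = z1 - z" by (simp flip: z0(1))
      then show "central_direction (x - z + c *s z0)"
        using central[OF z1 z(1,2) \<open>x \<in> Y\<close> \<open>x \<in> T\<close> z(3)] by (simp only:)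
      show "\<forall>i. z0 $ i \<in> centre" "c \<noteq> 0" by fact+
      show "z0 \<notin> left.add_ray {0} (x - z)"
      proof
        assume "z0 \<in> left.add_ray {0} (x - z)"
        then obtain e where "z0 = e *s (x - z)" using left.mem_ray by blast
        then have "z1 - x = c *s (e *s (x - z))" using z0(1) by metis
        also have "\<dots> = - (c * e) *s (z - x)" by (simp add: vec_eq_iff algebra_simps)
        finally have "z1 - x = - (c * e) *s (z - x)" .
        then have "z1 - x \<in> left.add_ray {0} t" using left.sub_scale[OF sub zt] by metis
        then have "z1 \<in> T" unfolding T_def
          using left.affine_mem_iff[OF left.affine_line left.line_mem(1)] left.direction_line by metis
        then show False using z1 by blast
      qed
    qed
    then obtain z' where "x - z = c *s z'" "\<forall>i. z' $ i \<in> centre" by blast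
    then have "z - x = c *s (- z')" "\<forall>i. (- z') $ i \<in> centre"
      by (auto simp: vec_eq_iff centre_def algebra_simps)
    then show ?thesis by blast
  qed
  have Y: "\<exists>z'. z - x = c *s z' \<and> (\<forall>i. z' $ i \<in> centre)" if "z \<in> Y" for z
  proof (cases "z = x")
    case True
    then show ?thesis by (intro exI[of _ 0]) (simp add: centre_def)
  qed (use outside inside that in blast)

  obtain i j :: 'n where ij: "i \<noteq> j"
    using n by (metis card_2_iff' UNIV_I)
  \<comment> \<open>After shifting by \<open>x\<close> and removing \<open>c\<close>, this is a
    point with coordinates 0 and \<open>b\<close>. A line of slope \<open>m'\<close> through it
    meets a point with central coordinates only if \<open>b + z' $ i * m' = z' $ j\<close>; then
    \<open>b\<close> is central or \<open>m'\<close> is a combination of \<open>b\<close> and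
    central elements, and in both cases \<open>m'\<close> commutes with \<open>b\<close>.\<close>
  define q where "q = x + c *s axis j b"
  define dir where "dir m' = axis i 1 + axis j m'" for m' :: 'a
  have dir: "dir m' $ i = 1" "dir m' $ j = m'" for m'
    using ij by (simp_all add: dir_def axis_def)
  have avoid: "left.line q (dir m') \<inter> Y = {}" if m': "m' * b \<noteq> b * m'" for m'
  proof (rule ccontr)
    assume "\<not> ?thesis"
    then obtain z where z: "z \<in> Y" "z \<in> left.line q (dir m')" by blast
    obtain lam where la: "z = q + lam *s dir m'" using z unfolding left.line_def by blast
    obtain z' where z': "z - x = c *s z'" "\<And>i. z' $ i \<in> centre" using Y z by blast
    have eq: "c *s axis j b + lam *s dir m' = c *s z'" using z'(1) la by (simp add: q_def)
    have "lam = c * z' $ i" using arg_cong[OF eq, of "\<lambda>x. x $ i"] dir ij by (simp add: axis_def)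
    moreover have "c * b + lam * m' = c * z' $ j"
      using arg_cong[OF eq, of "\<lambda>x. x $ j"] dir by (simp add: axis_def)
    ultimately have "c * (b + z' $ i * m') = c * z' $ j" by (simp add: algebra_simps)
    then have *: "b + z' $ i * m' = z' $ j" using \<open>c \<noteq> 0\<close> by simp
    have "z' $ i \<noteq> 0"
    proof
      assume "z' $ i = 0"
      then have "b = z' $ j" using * by simp
      then show False using m' z'(2) central_commute by metis
    qed
    have "z' $ i * (m' * b) = (z' $ j - b) * b" using *[symmetric] by (simp add: mult.assoc)
    also have "\<dots> = b * (z' $ j - b)"
      using central_commute[OF z'(2), of j b] by (simp add: algebra_simps)
    also have "\<dots> = z' $ i * (b * m')"
      using *[symmetric] central_commute[OF z'(2), of i b] by (simp add: mult.assoc[symmetric])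
    finally show False using m' \<open>z' $ i \<noteq> 0\<close> by simp
  qed
  have image: "F ` left.line q (dir m') = left.line (F q) w" if m': "m' * b \<noteq> b * m'" for m'
  proof -
    have nc: "\<not> central_direction (dir m')"
    proof
      assume "central_direction (dir m')"
      then obtain e where e: "right_scale b (dir m') = e *s dir m'" using central_directionD_right by blast
      have "right_scale b (dir m') $ k = (e *s dir m') $ k" for k by (simp only: e)
      from this[of i] this[of j] have "b = e" "m' * b = e * m'"
        by (simp_all add: right_scale_def dir)
      then show False using m' by simp
    qed
    then have 1: "F ` left.line q (dir m') = left.line (F q) (\<delta> q (dir m'))"
      using pure unfolding pure_pos_iff pos_def by blast
    have "l \<inter> F ` left.line q (dir m') = {}" using avoid[OF m'] unfolding Y_def by blast
    then have "\<delta> q (dir m') \<in> left.add_ray {0} w"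
      using disjoint_left_lines_parallel[OF n \<open>w \<noteq> 0\<close>] 1 unfolding l_def by metis
    moreover have "\<delta> q (dir m') \<noteq> 0" using nc central_zero \<delta>_nonzero by metis
    ultimately show ?thesis using 1 left.line_eq[OF left.line_mem(1)] left.mem_ray by metis
  qed
  \<comment> \<open>Together with \<open>m\<close>, also \<open>m + 1\<close> fails to commute with
    \<open>b\<close>, which gives two different slopes with the same image line.\<close>
  have "left.line q (dir m) = left.line q (dir (m + 1))"
    using image[of m] image[of "m + 1"] bm inj_F
    by (metis (no_types, lifting) distrib_left distrib_right add_right_cancel inj_image_eq_iff mult.left_neutral mult.right_neutral)
  then have "q + dir m \<in> left.line q (dir (m + 1))" using left.line_mem(2) by metis
  then obtain e where e: "dir m = e *s dir (m + 1)" unfolding left.line_def by auto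
  show False
    using arg_cong[OF e, of "\<lambda>x. x $ i"] arg_cong[OF e, of "\<lambda>x. x $ j"] dir by simp
qed

lemma pure_pos_imp_left:
  assumes "CARD('n) \<ge> 2" "\<exists>a b :: 'a. a * b \<noteq> b * a" "pure_pos F"
  shows "left_affine (F ` left.line x v)"
proof -
  have "left.line x 0 = {x}" unfolding left.line_def by auto
  moreover have "left_affine {F x}" using left.affine_line[of "F x" 0] unfolding left.line_def by simp
  ultimately have "left_affine (F ` left.line x v)" if "v = 0" using that by simp
  moreover have "left_affine (F ` left.line x v)" if "\<not> central_direction v"
    using assms that unfolding pure_pos_def by blast
  moreover have "left_affine (F ` left.line x v)" if "v \<noteq> 0" "central_direction v"
    using assms that central_line_left_ge3 central_line_left_2
    by (cases "CARD('n) = 2") (metis, metis One_nat_def Suc_1 not_less_eq_eq numeral_3_eq_3 le_antisym)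
  ultimately show ?thesis by blast
qed

end

text \<open>Passing to opposite rings on both sides turns right lines into left ones. It keeps
  \<open>pure_pos\<close>, since a map that keeps the left line of a noncentral direction also keeps
  the right one (\<open>pos_iff\<close>).\<close>

lemma pure_pos_imp_right:
  fixes F :: "'a::division_ring ^ 'n::finite \<Rightarrow> 'b::division_ring ^ 'n"
  assumes "lr_map F" "CARD('n) \<ge> 2" "\<exists>a b :: 'a. a * b \<noteq> b * a" "pure_pos F"
  shows "right_affine (F ` right.line x v)"
proof -
  interpret lr_map F by fact
  let ?F = "(componentwise Opp \<circ> F) \<circ> componentwise unopp"
  interpret F': lr_map ?F
    by (intro lr_map_comp_anti lr_map_anti_comp assms(1) anti_iso_Opp anti_iso_unopp)
  have "pure_pos ?F" unfolding pure_pos_def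
  proof (intro allI impI)
    fix y u :: "'a opp ^ 'n" assume u: "\<not> central_direction u"
    then have "F ` right.line (componentwise unopp y) (componentwise unopp u) =
        right.line (F (componentwise unopp y)) (\<delta> (componentwise unopp y) (componentwise unopp u))"
      using assms(4) pure_pos_iff pos_iff unopp.central_componentwise by metis
    then have "right_affine (F ` componentwise unopp ` left.line y u)"
      using unopp.line_left right.affine_line by metis
    then show "left_affine (?F ` left.line y u)"
      unfolding image_comp[symmetric] by (rule Opp.affine_right)
  qed
  moreover have "\<exists>a b :: 'a opp. a * b \<noteq> b * a"
    using assms(3) unfolding times_opp_def by (metis opp.sel)
  ultimately have "left_affine (?F ` left.line (componentwise Opp x) (componentwise Opp v))"
    using F'.pure_pos_imp_left assms(2) by blast
  then have "left_affine (componentwise Opp ` F ` right.line x v)"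
    unfolding Opp.line_right[symmetric] image_comp[symmetric]
    by (simp add: image_image componentwise_unopp_Opp)
  then have "right_affine (componentwise unopp ` componentwise Opp ` F ` right.line x v)"
    by (rule unopp.affine_left)
  then show ?thesis by (simp add: image_image componentwise_unopp_Opp)
qed

section \<open>Semilinearity and the standard form\<close>

lemma scale_cancel: "c *s g = d *s g \<Longrightarrow> g \<noteq> 0 \<Longrightarrow> c = d" for g :: "'a::division_ring ^ 'n::finite"
  by (auto simp: vec_eq_iff)

lemma ray_subset:
  "w \<in> left.add_ray {0} x \<Longrightarrow> left.add_ray {0} w \<subseteq> left.add_ray {0} (x :: 'a::division_ring ^ 'n::finite)"
  using left.sub_add_ray[OF left.sub_singleton_0] by (intro left.add_ray_least) (auto simp: left.sub_zero)

lemma scale_mem_ray: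
  fixes x y :: "'a::division_ring ^ 'n::finite"
  shows "r *s x = t *s y \<Longrightarrow> t \<noteq> 0 \<Longrightarrow> y \<in> left.add_ray {0} x"
  using left.sub_scale_iff[OF left.sub_add_ray[OF left.sub_singleton_0]] left.mem_ray by metis

lemma span2_unique:
  fixes x y :: "'a::division_ring ^ 'n::finite"
  assumes "a *s x + b *s y = c *s x + d *s y" "x \<noteq> 0" "y \<notin> left.add_ray {0} x"
  shows "a = c" "b = d"
proof -
  have eq: "(a - c) *s x = (d - b) *s y" using assms(1) by (simp add: vec_eq_iff algebra_simps)
  then show "b = d" using scale_mem_ray assms(3) by (metis right_minus_eq)
  then show "a = c" using eq assms(2) by (auto simp: vec_eq_iff)
qed

locale left_map = lr_map F for F :: "'a::division_ring ^ 'n::finite \<Rightarrow> 'b::division_ring ^ 'n" +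
  assumes left_lines: "left_affine (F ` left.line x v)"
    and dim_ge2: "CARD('n) \<ge> 2"
begin

lemma line_image: "v \<noteq> 0 \<Longrightarrow> F ` left.line x v = left.line (F x) (\<delta> x v)"
  using left_lines left_line_affine_iff pos_def by blast

text \<open>If the image is right, the image lines from \<open>F x\<close> to its other points also
  close its direction under left multiples. Taking subspaces from \<open>lr\<close> instead of
  building them out of lines matters over the field with two elements, where every pair of points is
  a line.\<close>

lemma affine_image:
  assumes A: "left_affine A"
  shows "left_affine (F ` A)"
proof -
  obtain x where x: "x \<in> A" using left.affine_nonempty[OF A] by blast
  have "left_affine (F ` A)" if r: "right_affine (F ` A)"
  proof -
    let ?D = "direction (F ` A)"
    have Fx: "F x \<in> F ` A" using x by blast
    have "c *s d \<in> ?D" if d: "d \<in> ?D" for c d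
    proof (cases "d = 0")
      case True then show ?thesis using d by simp
    next
      case False
      have "F x + d \<in> F ` A" using right.affine_mem_iff[OF r Fx] d by simp
      then obtain y where y: "y \<in> A" "F y = F x + d" by (metis imageE)
      then have "y - x \<noteq> 0" using False by auto
      then have "F ` left.line x (y - x) = left.line (F x) d"
        using line_image[of "y - x" x] y unfolding \<delta>_def by simp
      moreover have "left.line x (y - x) \<subseteq> A"
        using A x y by (intro left.line_subset direction_memI)
      ultimately have "left.line (F x) d \<subseteq> F ` A" by (metis image_mono)
      then have "F x + c *s d \<in> F ` A" unfolding left.line_def by blast
      then show ?thesis using right.affine_mem_iff[OF r Fx] by simp
    qed
    then have "vsubspace (*s) ?D"
      using right.sub_direction[OF r] unfolding vsubspace_def by blast
    then show ?thesis
      using left.affine_translate right.affine_eq_translate[OF r Fx] by metis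
  qed
  then show ?thesis using lr A by blast
qed

text \<open>Distinct parallel lines lie in a common plane, whose image is a left plane. Independent
  image directions would span the direction of that plane, so the image lines would meet, against
  injectivity.\<close>

lemma parallel:
  assumes "v \<noteq> 0"
  shows "\<delta> y v \<in> left.add_ray {0} (\<delta> x v)"
proof (cases "y - x \<in> left.add_ray {0} v")
  case True
  then have "y \<in> left.line x v"
    using left.affine_mem_iff[OF left.affine_line left.line_mem(1)] left.direction_line by metis
  then have "left.line y v = left.line x v"
    using left.line_eq[of y x v v 1] assms by (simp add: left.s_one)
  then have "left.line (F y) (\<delta> y v) = left.line (F x) (\<delta> x v)" using line_image[OF assms] by metis
  then have "left.add_ray {0} (\<delta> y v) = left.add_ray {0} (\<delta> x v)" using left.direction_line by metis
  then show ?thesis using left.add_ray_mem[OF left.sub_singleton_0] by blast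
next
  case False
  let ?V = "left_span2 v (y - x)"
  let ?A = "(\<lambda>v. x + v) ` ?V"
  have A: "left_affine ?A" and dA: "direction ?A = ?V"
    by (simp_all add: left.affine_translate sub_left_span2 left.direction_translate_sub)
  have lA: "left_affine (F ` ?A)" using A by (rule affine_image)
  have pivot_dim: "pivot_dim (direction (F ` ?A)) = 2"
    using pivot_dim_image[of ?A] A dA pivot_dim_left_span2[OF assms False] by simp
  have x: "x \<in> ?A" by (rule image_eqI[of _ _ 0]) simp_all
  have y: "y \<in> ?A" by (rule image_eqI[of _ _ "y - x"]) simp_all
  have "\<delta> z v \<in> direction (F ` ?A)" if "z \<in> ?A" for z
  proof -
    have "left.line z v \<subseteq> ?A" using left.line_subset[OF A that] dA by simp
    then have "z + v \<in> ?A" using left.line_mem by blast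
    then show ?thesis unfolding \<delta>_def using that by (intro direction_memI imageI)
  qed
  then have d: "\<delta> x v \<in> direction (F ` ?A)" "\<delta> y v \<in> direction (F ` ?A)" using x y by blast+
  have yx: "F y - F x \<in> direction (F ` ?A)" using x y by (intro direction_memI imageI)
  show ?thesis
  proof (rule ccontr)
    assume "\<not> ?thesis"
    then have "pivot_dim (left_span2 (\<delta> x v) (\<delta> y v)) = 2"
      using \<delta>_nonzero[OF assms] by (intro pivot_dim_left_span2)
    then have "left_span2 (\<delta> x v) (\<delta> y v) = direction (F ` ?A)"
      using d pivot_dim left.sub_direction[OF lA]
      by (intro left.sub_eqI sub_left_span2 left.add_ray_least) (auto intro: left.sub_diff simp: left.sub_zero)
    then obtain a b where "F y - F x = a *s \<delta> x v + b *s \<delta> y v" using yx mem_left_span2 by blast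
    then have "F x + a *s \<delta> x v = F y + (- b) *s \<delta> y v" by (simp add: vec_eq_iff algebra_simps)
    moreover have "F x + a *s \<delta> x v \<in> left.line (F x) (\<delta> x v)"
      "F y + (- b) *s \<delta> y v \<in> left.line (F y) (\<delta> y v)"
      unfolding left.line_def by blast+
    then have "F x + a *s \<delta> x v \<in> F ` left.line x v" "F y + (- b) *s \<delta> y v \<in> F ` left.line y v"
      unfolding line_image[OF assms] .
    ultimately have "F x + a *s \<delta> x v \<in> F ` (left.line x v \<inter> left.line y v)"
      unfolding image_Int[OF inj_F] by simp
    then obtain z where "z \<in> left.line x v" "z \<in> left.line y v" by blast
    then obtain c e where "x + c *s v = y + e *s v" unfolding left.line_def by auto
    then have "y - x = (c - e) *s v" by (simp add: vec_eq_iff algebra_simps)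
    then show False using False left.mem_ray by blast
  qed
qed

section \<open>Additivity and the ring isomorphism\<close>

definition G :: "'a ^ 'n \<Rightarrow> 'b ^ 'n" where
  "G x = F x - F 0"

lemma G_zero [simp]: "G 0 = 0"
  by (simp add: G_def)

lemma G_eq_iff: "G x = G y \<longleftrightarrow> x = y"
  using inj_F by (simp add: G_def inj_eq)

lemma G_nonzero: "x \<noteq> 0 \<Longrightarrow> G x \<noteq> 0"
  using G_eq_iff[of x 0] by simp

lemma image_ray:
  assumes "x \<noteq> 0"
  shows "F ` left.line 0 x = left.line (F 0) (G x)"
  using line_image[OF assms, of 0] by (simp add: \<delta>_def G_def)

lemma G_mem_ray_iff:
  assumes "x \<noteq> 0"
  shows "G y \<in> left.add_ray {0} (G x) \<longleftrightarrow> y \<in> left.add_ray {0} x"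
proof -
  have "G y \<in> left.add_ray {0} (G x) \<longleftrightarrow> F y \<in> left.line (F 0) (G x)"
    using left.affine_mem_iff[OF left.affine_line left.line_mem(1)] left.direction_line G_def by metis
  also have "\<dots> \<longleftrightarrow> y \<in> left.line 0 x"
    using image_ray[OF assms] inj_F by (metis inj_image_mem_iff)
  also have "\<dots> \<longleftrightarrow> y \<in> left.add_ray {0} x"
    using left.affine_mem_iff[OF left.affine_line left.line_mem(1), of y 0 x] left.direction_line[of 0 x] by simp
  finally show ?thesis .
qed

text \<open>The parallelogram: reaching \<open>x + y\<close> along the two parallels gives
  \<open>a *s G x + G y\<close> and \<open>G x + b *s G y\<close>, and independence of
  \<open>G x\<close> and \<open>G y\<close> forces \<open>a = 1\<close>.\<close>

lemma G_add_independent: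
  assumes "x \<noteq> 0" "y \<notin> left.add_ray {0} x"
  shows "G (x + y) = G x + G y"
proof -
  have "y \<noteq> 0" using assms left.sub_zero[OF left.sub_add_ray[OF left.sub_singleton_0]] by blast
  obtain a where a: "\<delta> y x = a *s G x"
    using parallel[OF assms(1), of y 0] left.mem_ray by (auto simp: \<delta>_def G_def)
  obtain b where b: "\<delta> x y = b *s G y"
    using parallel[OF \<open>y \<noteq> 0\<close>, of x 0] left.mem_ray by (auto simp: \<delta>_def G_def)
  have 1: "G (x + y) = a *s G x + 1 *s G y" using a by (simp add: \<delta>_def G_def algebra_simps)
  moreover have "G (x + y) = 1 *s G x + b *s G y" using b by (simp add: \<delta>_def G_def algebra_simps)
  ultimately have "a = 1"
    using span2_unique(1)[of a "G x" 1 "G y" 1 b] G_nonzero assms G_mem_ray_iff by metis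
  then show ?thesis using 1 by simp
qed

lemma exists_independent: "\<exists>z. z \<notin> left.add_ray {0} (x :: 'a ^ 'n)"
proof (rule ccontr)
  assume "\<not> ?thesis"
  then have "left.add_ray {0} x = UNIV" by blast
  then have "pivot_dim (left.add_ray {0} x) \<ge> 2" using pivot_dim_UNIV dim_ge2 by metis
  moreover have "left.add_ray {0} x = {0}" if "x = 0" using that by (auto simp: left.mem_ray)
  ultimately show False using left.pivot_dim_line[of x] by (cases "x = 0") (auto simp: pivot_dim_singleton_0)
qed

text \<open>On a common ray, an auxiliary \<open>z\<close> off it lets \<open>G (x + y + z)\<close>
  be split in two ways, each time into independent summands.\<close>

lemma G_add: "G (x + y) = G x + G y"
proof (cases "x = 0 \<or> y = 0 \<or> y \<notin> left.add_ray {0} x")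
  case True
  then show ?thesis using G_add_independent by (cases "x = 0") auto
next
  case False
  note sub = left.sub_add_ray[OF left.sub_singleton_0]
  obtain z where z: "z \<notin> left.add_ray {0} x" using exists_independent by blast
  have z': "z \<notin> left.add_ray {0} w" if "w \<in> left.add_ray {0} x" for w
    using z that ray_subset by blast
  have "y + z \<notin> left.add_ray {0} x" using False z left.sub_diff[OF sub, where x = "y + z" and y = y] by auto
  then have "G (x + (y + z)) = G x + G (y + z)" using False by (intro G_add_independent) auto
  also have "G (y + z) = G y + G z" using False z' by (intro G_add_independent) auto
  finally have 1: "G (x + y + z) = G x + (G y + G z)" by (simp add: add.assoc)
  have "x + y \<in> left.add_ray {0} x"
    using False left.sub_add[OF sub] left.add_ray_mem[OF left.sub_singleton_0] by blast
  then have "G (x + y + z) = G (x + y) + G z"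
    using z' by (cases "x + y = 0") (auto intro: G_add_independent)
  with 1 show ?thesis by (simp add: add.assoc[symmetric])
qed

definition ray_factor :: "'a \<Rightarrow> 'a ^ 'n \<Rightarrow> 'b" where
  "ray_factor c x = (SOME r. G (c *s x) = r *s G x)"

lemma G_scale_ray_factor:
  assumes "x \<noteq> 0"
  shows "G (c *s x) = ray_factor c x *s G x"
proof -
  have "c *s x \<in> left.add_ray {0} x" using left.mem_ray by blast
  then have "\<exists>r. G (c *s x) = r *s G x" using G_mem_ray_iff[OF assms] left.mem_ray by metis
  then show ?thesis unfolding ray_factor_def by (rule someI_ex)
qed

text \<open>Expanding \<open>G (c *s (x + y))\<close> in two ways equates both factors with that of
  \<open>x + y\<close>.\<close>

lemma ray_factor_independent:
  assumes "x \<noteq> 0" "y \<notin> left.add_ray {0} x"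
  shows "ray_factor c x = ray_factor c y"
proof -
  have "y \<noteq> 0" "x + y \<noteq> 0"
    using assms left.sub_zero[OF left.sub_add_ray[OF left.sub_singleton_0]]
      left.sub_uminus[OF left.sub_add_ray[OF left.sub_singleton_0] left.add_ray_mem[OF left.sub_singleton_0], of x]
    by (auto simp: add_eq_0_iff)
  have "ray_factor c x *s G x + ray_factor c y *s G y = G (c *s x + c *s y)"
    using \<open>y \<noteq> 0\<close> assms by (simp add: G_add G_scale_ray_factor)
  also have "\<dots> = G (c *s (x + y))" by (simp add: left.s_add)
  also have "\<dots> = ray_factor c (x + y) *s (G x + G y)"
    using G_scale_ray_factor[OF \<open>x + y \<noteq> 0\<close>] G_add by metis
  finally have "ray_factor c x *s G x + ray_factor c y *s G y = ray_factor c (x + y) *s G x + ray_factor c (x + y) *s G y"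
    by (simp add: left.s_add)
  then show ?thesis
    using span2_unique[of "ray_factor c x" "G x" "ray_factor c y" "G y" "ray_factor c (x + y)" "ray_factor c (x + y)"]
      G_nonzero assms G_mem_ray_iff by metis
qed

lemma ray_factor_const:
  assumes "x \<noteq> 0" "y \<noteq> 0"
  shows "ray_factor c x = ray_factor c y"
proof (cases "y \<in> left.add_ray {0} x")
  case True
  obtain z where z: "z \<notin> left.add_ray {0} x" using exists_independent by blast
  moreover have "z \<notin> left.add_ray {0} y"
    using z True ray_subset by blast
  ultimately show ?thesis using ray_factor_independent assms by metis
qed (use ray_factor_independent assms in blast)

lemma semilinear:
  "\<exists>\<sigma>. bij \<sigma> \<and> (\<forall>c d. \<sigma> (c + d) = \<sigma> c + \<sigma> d) \<and> (\<forall>c d. \<sigma> (c * d) = \<sigma> c * \<sigma> d) \<and>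
    (\<forall>c x. G (c *s x) = \<sigma> c *s G x)"
proof -
  obtain z :: "'a ^ 'n" where "z \<notin> left.add_ray {0} 0" using exists_independent by blast
  then have z: "z \<noteq> 0" using left.sub_zero[OF left.sub_add_ray[OF left.sub_singleton_0]] by blast
  define \<sigma> where "\<sigma> c = ray_factor c z" for c
  have scale: "G (c *s x) = \<sigma> c *s G x" for c x
    using G_scale_ray_factor ray_factor_const[OF _ z] unfolding \<sigma>_def by (cases "x = 0") auto
  have Gz: "G z \<noteq> 0" using z by (rule G_nonzero)
  have "\<sigma> (c + d) *s G z = (\<sigma> c + \<sigma> d) *s G z" for c d
    by (simp only: scale[symmetric] left.add_s G_add)
  then have add: "\<sigma> (c + d) = \<sigma> c + \<sigma> d" for c d using scale_cancel Gz by blast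
  have "(c * d) *s z = c *s (d *s z)" for c d by (simp add: vec_eq_iff mult.assoc)
  then have "\<sigma> (c * d) *s G z = \<sigma> c *s (\<sigma> d *s G z)" for c d
    by (metis scale)
  then have "\<sigma> (c * d) *s G z = (\<sigma> c * \<sigma> d) *s G z" for c d
    by (simp add: vec_eq_iff mult.assoc)
  then have mult: "\<sigma> (c * d) = \<sigma> c * \<sigma> d" for c d using scale_cancel Gz by blast
  have "inj \<sigma>"
  proof (rule injI)
    fix c d assume "\<sigma> c = \<sigma> d"
    then have "c *s z = d *s z" using scale G_eq_iff by metis
    then show "c = d" using z by (rule scale_cancel)
  qed
  \<comment> \<open>Lines go onto lines and not merely into them, which makes
    \<open>\<sigma>\<close> surjective.\<close>
  moreover have "\<exists>c. r = \<sigma> c" for r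
  proof -
    have "F 0 + r *s G z \<in> left.line (F 0) (G z)"
      unfolding left.line_def by blast
    then have "F 0 + r *s G z \<in> F ` left.line 0 z" by (simp only: image_ray[OF z])
    then obtain c where "F 0 + r *s G z = F (c *s z)" unfolding left.line_def by auto
    then have "r *s G z = \<sigma> c *s G z" using scale[of c z] by (simp add: G_def algebra_simps)
    then show ?thesis using scale_cancel Gz by blast
  qed
  ultimately have "bij \<sigma>" by (auto simp: bij_def)
  then show ?thesis using add mult scale by blast
qed

section \<open>Two-sided lines and the standard form\<close>

lemma central_image:
  assumes t: "central_direction t" "t \<noteq> 0" and right: "right_affine (F ` right.line 0 t)"
  shows "central_direction (G t)"
proof -
  have eq: "right.line 0 t = left.line 0 t" using central_direction_lines[OF t(1)] by metis
  have "F ` left.line 0 t = right.line (F 0) (F t - F 0)"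
  proof (rule right.line_unique)
    show "right_affine (F ` left.line 0 t)" using right eq by simp
    show "pivot_dim (direction (F ` left.line 0 t)) = 1"
      using pivot_dim_image[of "left.line 0 t"] left.affine_line left.direction_line left.pivot_dim_line[OF t(2)] by metis
    show "F 0 \<in> F ` left.line 0 t" "F t \<in> F ` left.line 0 t"
      using left.line_mem[of 0 t] by (auto simp only: add_0 intro: imageI)
    show "F 0 \<noteq> F t" using t inj_F by (simp add: inj_eq)
  qed
  then show ?thesis using image_ray[OF t(2)] lines_eq_central unfolding G_def by metis
qed

end

text \<open>Removing the twist \<open>\<sigma>\<close> from \<open>G\<close> leaves a left linear
  \<open>H\<close> with rows \<open>a *s Z i\<close>. In \<open>x $ i *s (a *s Z i)\<close> the
  common factor stands next to \<open>x $ i\<close>, so it becomes a right multiplication of the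
  argument and leaves the central rows to \<open>g\<close>.\<close>

lemma standard_form:
  fixes F :: "'a::division_ring ^ 'n::finite \<Rightarrow> 'a ^ 'n"
  assumes "left_map F" and right: "\<And>x v. right_affine (F ` right.line x v)"
  shows "preserves_left_affine F \<and> has_standard_form F"
proof
  interpret left_map F by fact
  show "preserves_left_affine F"
    unfolding preserves_left_affine_def using affine_image affine_dim_image by blast
  obtain \<sigma> where \<sigma>: "bij \<sigma>" "\<And>c d. \<sigma> (c + d) = \<sigma> c + \<sigma> d" "\<And>c d. \<sigma> (c * d) = \<sigma> c * \<sigma> d"
    "\<And>c x. G (c *s x) = \<sigma> c *s G x" using semilinear by blast
  define \<tau> where "\<tau> = inv \<sigma>"
  have st: "\<sigma> (\<tau> c) = c" "\<tau> (\<sigma> c) = c" for c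
    using \<sigma>(1) by (simp_all add: \<tau>_def bij_is_surj surj_f_inv_f bij_is_inj)
  have \<tau>: "\<tau> (c + d) = \<tau> c + \<tau> d" "\<tau> (c * d) = \<tau> c * \<tau> d" for c d
    using \<sigma> st by metis+
  define H where "H x = componentwise \<tau> (G x)" for x
  have H_add: "H (x + y) = H x + H y" for x y
    by (simp add: H_def G_add componentwise_def \<tau> vec_eq_iff)
  have H_scale: "H (c *s x) = c *s H x" for c x
    by (simp add: H_def \<sigma>(4) componentwise_def \<tau> st vec_eq_iff)
  have H_eq: "H x = H y \<longleftrightarrow> x = y" for x y
  proof
    assume "H x = H y"
    then have "componentwise \<sigma> (H x) = componentwise \<sigma> (H y)" by simp
    then have "G x = G y" by (simp add: H_def componentwise_def st)
    then show "x = y" by (simp add: G_eq_iff)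
  qed simp
  have H_zero: "H 0 = 0" using H_add[of 0 0] by simp
  have H_sum: "H (\<Sum>i\<in>I. g i) = (\<Sum>i\<in>I. H (g i))" for g :: "'n \<Rightarrow> 'a ^ 'n" and I
    by (induction I rule: infinite_finite_induct) (auto simp: H_zero H_add)
  have central: "central_direction (H t)" if t: "\<forall>i. t $ i \<in> centre" "t \<noteq> 0" for t
  proof -
    have "t = 1 *s t" by (simp add: left.s_one)
    then have "central_direction t" using t unfolding central_direction_def by blast
    then obtain c z where z: "G t = c *s z" "\<And>i. z $ i \<in> centre"
      using central_image[OF _ t(2) right] unfolding central_direction_def by blast
    have "H t = \<tau> c *s componentwise \<tau> z" by (simp add: H_def z componentwise_def \<tau> vec_eq_iff)
    moreover have "componentwise \<tau> z $ i \<in> centre" for i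
    proof -
      have "\<tau> (z $ i) * x = x * \<tau> (z $ i)" for x
        using central_commute[OF z(2), of i "\<sigma> x"] \<tau> st by metis
      then show ?thesis by (simp add: componentwise_def centre_def)
    qed
    ultimately show ?thesis unfolding central_direction_def by blast
  qed
  have axis_centre: "axis i 1 $ j \<in> (centre :: 'a set)" for i j :: 'n by (simp add: axis_def centre_def)
  have axis_nonzero: "axis i 1 \<noteq> (0 :: 'a ^ 'n)" for i by (simp add: axis_def vec_eq_iff)
  \<comment> \<open>A reference row. Its factor is imposed on row \<open>i\<close> through
    \<open>axis i 1 + axis i0 1\<close>, whose image is again a central direction.\<close>
  fix i0 :: 'n
  have "central_direction (H (axis i0 1))" using central axis_centre axis_nonzero by blast
  then obtain a z0 where z0: "H (axis i0 1) = a *s z0" "\<forall>i. z0 $ i \<in> centre"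
    unfolding central_direction_def by blast
  have "a \<noteq> 0" using z0(1) H_eq[of "axis i0 1" 0] axis_nonzero[of i0] by (auto simp: H_zero)
  have "\<exists>z. H (axis i 1) = a *s z \<and> (\<forall>j. z $ j \<in> centre)" for i
  proof (cases "i = i0")
    case False
    show ?thesis
    proof (rule central_sum_scale)
      show "central_direction (H (axis i 1))" using central axis_centre axis_nonzero by blast
      have ne: "axis i 1 + axis i0 1 \<noteq> (0 :: 'a ^ 'n)"
        using False by (auto simp: vec_eq_iff axis_def intro!: exI[of _ i])
      have ce: "\<forall>j. (axis i 1 + axis i0 1 :: 'a ^ 'n) $ j \<in> centre"
        using False by (auto simp: axis_def centre_def)
      show "central_direction (H (axis i 1) + a *s z0)"
        using central[OF ce ne] by (simp add: H_add z0)
      show "z0 \<notin> left.add_ray {0} (H (axis i 1))"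
      proof
        assume "z0 \<in> left.add_ray {0} (H (axis i 1))"
        then obtain e where "z0 = e *s H (axis i 1)" using left.mem_ray by blast
        then have "H (axis i0 1) = H (a *s (e *s axis i 1))" by (simp add: z0 H_scale)
        then have "(axis i0 1 :: 'a ^ 'n) = a *s (e *s axis i 1)" by (simp add: H_eq)
        then have "(axis i0 1 :: 'a ^ 'n) $ i0 = (a *s (e *s axis i 1)) $ i0" by simp
        then show False using False by (simp add: axis_def)
      qed
    qed (use z0 \<open>a \<noteq> 0\<close> in auto)
  qed (use z0 in auto)
  then obtain Z where Z: "\<And>i. H (axis i 1) = a *s Z i" "\<And>i j. Z i $ j \<in> centre" by metis
  define g where "g x = (\<Sum>i\<in>UNIV. x $ i *s Z i)" for x
  have "left_linear g"
    unfolding left_linear_def g_def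
    by (auto simp: left.add_s sum.distrib left.s_sum vec_eq_iff mult.assoc)
  moreover have "g (axis i 1) = Z i" for i
    unfolding g_def by (simp add: vec_eq_iff axis_def if_distrib if_distribR cong: if_cong)
  then have "defined_over_centre g" unfolding defined_over_centre_def using Z by simp
  moreover have "ring_automorphism \<sigma>" using \<sigma> by (simp add: ring_automorphism_def)
  \<comment> \<open>The required form has the translation inside \<open>\<sigma>\<close>, hence the
    inverse \<open>\<tau>\<close> on \<open>F 0\<close>.\<close>
  moreover have "F x = componentwise \<sigma> (g (right_scale a x) + componentwise \<tau> (F 0))" for x
  proof -
    have "H x = (\<Sum>i\<in>UNIV. x $ i *s (a *s Z i))"
      by (subst vec_eq_sum_axis[of x]) (simp only: H_sum H_scale Z)
    also have "\<dots> = g (right_scale a x)"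
      unfolding g_def right_scale_def by (simp add: vec_eq_iff mult.assoc)
    finally have "componentwise \<sigma> (g (right_scale a x) + componentwise \<tau> (F 0)) =
        componentwise \<sigma> (H x) + componentwise \<sigma> (componentwise \<tau> (F 0))"
      by (simp add: componentwise_def \<sigma> vec_eq_iff)
    also have "\<dots> = G x + F 0" by (simp add: H_def componentwise_def st)
    finally show ?thesis by (simp add: G_def)
  qed
  ultimately show "has_standard_form F" unfolding has_standard_form_def by blast
qed

section \<open>Purely left lines in a plane and the anti-automorphism\<close>

lemma standard_form_pure_pos:
  fixes f :: "'a::division_ring ^ 'n::finite \<Rightarrow> 'a ^ 'n"
  assumes "lr_map f" "CARD('n) \<ge> 2" "pure_pos f"
  shows "preserves_left_affine f \<and> has_standard_form f"
proof -
  interpret lr_map f by fact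
  have lr_lines: "left_affine (f ` left.line x v) \<and> right_affine (f ` right.line x v)" for x v
  proof (cases "\<exists>a b :: 'a. a * b \<noteq> b * a")
    case True
    then show ?thesis using pure_pos_imp_left pure_pos_imp_right assms by blast
  next
    case False
    then have "(right_scale :: 'a \<Rightarrow> 'a ^ 'n \<Rightarrow> 'a ^ 'n) = (*s)"
      by (simp add: fun_eq_iff right_scale_def vec_eq_iff)
    then show ?thesis using lr left.affine_line right.affine_line by metis
  qed
  then have "left_map f" using assms(2) by unfold_locales auto
  then show ?thesis using lr_lines by (intro standard_form) auto
qed

text \<open>Passes from the notions of the statement to base points and noncentral directions, with
  which the proof works.\<close>

lemma purely_left_line_iff:
  fixes L :: "('a::division_ring ^ 'n::finite) set"
  shows "purely_left L \<and> affine_dim L = 1 \<longleftrightarrow> (\<exists>x v. L = left.line x v \<and> \<not> central_direction v)"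
proof
  assume L: "purely_left L \<and> affine_dim L = 1"
  then have l: "left_affine L" "\<not> right_affine L" "pivot_dim (direction L) = 1"
    using affine_dim_eq_pivot_dim[of L] unfolding purely_left_def by auto
  obtain x where x: "x \<in> L" using left.affine_nonempty[OF l(1)] by blast
  have "direction L \<noteq> {0}" using l(3) pivot_dim_singleton_0 by (metis zero_neq_one)
  then obtain v where v: "v \<in> direction L" "v \<noteq> 0"
    using left.sub_zero[OF left.sub_direction[OF l(1)]] by blast
  then have "x + v \<in> L" using left.affine_mem_iff[OF l(1) x] by simp
  then have "L = left.line x v" using left.line_unique[OF l(1,3) x] v(2) by fastforce
  then show "\<exists>x v. L = left.line x v \<and> \<not> central_direction v"
    using l(2) central_direction_lines right.affine_line by metis
next
  assume "\<exists>x v. L = left.line x v \<and> \<not> central_direction v"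
  then obtain x v where L: "L = left.line x v" and v: "\<not> central_direction v" by blast
  have v0: "v \<noteq> 0" using v central_zero by blast
  have l: "left_affine L" unfolding L by (rule left.affine_line)
  have pivot_dim: "pivot_dim (direction L) = 1" unfolding L left.direction_line by (rule left.pivot_dim_line[OF v0])
  have "\<not> right_affine L"
  proof
    assume r: "right_affine L"
    have "L = right.line x (x + v - x)"
      using left.line_mem[of x v] v0 unfolding L[symmetric]
      by (intro right.line_unique r pivot_dim) auto
    then show False using L v lines_eq_central[of x v] by simp
  qed
  then show "purely_left L \<and> affine_dim L = 1"
    using l pivot_dim affine_dim_eq_pivot_dim[of L] unfolding purely_left_def by simp
qed

text \<open>If all of \<open>c *s t + v\<close> were central, then \<open>v\<close> would be a left multiple of a vector over the
  centre with every scalar \<open>c\<close> as a possible factor.\<close>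

lemma exists_pure_direction:
  fixes V :: "('a::division_ring ^ 'n::finite) set"
  assumes V: "vsubspace (*s) V" "pivot_dim V = 2" and ab: "a * b \<noteq> b * (a :: 'a)"
  shows "\<exists>v\<in>V. \<not> central_direction v"
proof (rule ccontr)
  assume "\<not> ?thesis"
  then have central: "central_direction v" if "v \<in> V" for v using that by blast
  have "V \<noteq> {0}" using V(2) pivot_dim_singleton_0 by (metis zero_neq_numeral)
  then obtain v where v: "v \<in> V" "v \<noteq> 0" using left.sub_zero[OF V(1)] by blast
  have "left.add_ray {0} v \<noteq> V" using left.pivot_dim_line[OF v(2)] V(2) by auto
  moreover have "left.add_ray {0} v \<subseteq> V" using v V left.sub_zero by (intro left.add_ray_least) auto
  ultimately obtain y where y: "y \<in> V" "y \<notin> left.add_ray {0} v" by blast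
  obtain c t where t: "y = c *s t" "\<forall>i. t $ i \<in> centre"
    using central[OF y(1)] unfolding central_direction_def by blast
  have "t \<notin> left.add_ray {0} v"
    using y(2) t(1) left.sub_scale[OF left.sub_add_ray[OF left.sub_singleton_0]] by blast
  have "c \<noteq> 0" using y t left.sub_zero[OF left.sub_add_ray[OF left.sub_singleton_0], of v] by auto
  then have "t \<in> V" using y(1) t(1) left.sub_scale_iff[OF V(1)] by blast
  have z: "\<exists>z. v = e *s z \<and> (\<forall>i. z $ i \<in> centre)" if "e \<noteq> 0" for e
    using that t \<open>t \<notin> _\<close> \<open>t \<in> V\<close> v left.sub_add[OF V(1)] left.sub_scale[OF V(1)]
    by (intro central_sum_scale central) auto
  \<comment> \<open>With factor 1 the entry \<open>v $ i\<close> is central, with factor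
    \<open>a\<close> it is \<open>a\<close> times a central element; so \<open>a\<close> would
    commute with \<open>b\<close>.\<close>
  obtain z1 where z1: "v = 1 *s z1" "\<forall>i. z1 $ i \<in> centre" using z[of 1] by auto
  have "a \<noteq> 0" using ab by auto
  then obtain z2 where z2: "v = a *s z2" "\<forall>i. z2 $ i \<in> centre" using z by blast
  obtain i where i: "v $ i \<noteq> 0" using v by (auto simp: vec_eq_iff)
  have vi: "v $ i = a * z2 $ i" by (simp add: z2(1))
  have vc: "v $ i \<in> centre" using z1 by (simp add: left.s_one)
  have "(a * b) * z2 $ i = a * z2 $ i * b"
    using central_commute[of "z2 $ i" b] z2 by (simp add: mult.assoc)
  also have "\<dots> = b * a * z2 $ i"
    using central_commute[OF vc, of b] vi by (simp add: mult.assoc)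
  finally show False using ab i vi by simp
qed

lemma anti_iso_inv:
  assumes "anti_iso \<phi>"
  shows "anti_iso (inv \<phi>)"
proof -
  have "\<phi> (inv \<phi> y) = y" "inv \<phi> (\<phi> x) = x" for x y
    using assms by (simp_all add: anti_iso_def bij_is_surj surj_f_inv_f bij_is_inj)
  then show ?thesis using assms unfolding anti_iso_def by (metis bij_imp_bij_inv)
qed

theorem theorem1:
  fixes f :: "'a::division_ring ^ 'n::finite \<Rightarrow> 'a ^ 'n"
  assumes "inj f"
    and "\<And>A. left_affine A \<or> right_affine A \<Longrightarrow> left_affine (f ` A) \<or> right_affine (f ` A)"
  shows "(bij f \<and>
          (\<forall>A. left_affine A \<or> right_affine A \<longrightarrow> affine_dim (f ` A) = affine_dim A)) \<and>
         (\<forall>P. two_sided P \<and> affine_dim P = 2 \<longrightarrow>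
            (CARD('n) \<ge> 3 \<and>
             (\<exists>L\<subseteq>P. purely_left L \<and> affine_dim L = 1 \<and> left_affine (f ` L)) \<longrightarrow>
               preserves_left_affine f \<and> has_standard_form f) \<and>
            (CARD('n) \<ge> 2 \<and>
             (\<forall>L\<subseteq>P. purely_left L \<and> affine_dim L = 1 \<longrightarrow> right_affine (f ` L)) \<longrightarrow>
               (\<exists>\<epsilon>. ring_anti_automorphism \<epsilon> \<and>
                    preserves_left_affine (componentwise \<epsilon> \<circ> f) \<and>
                    has_standard_form (componentwise \<epsilon> \<circ> f))))"
proof -
  have lr_f: "lr_map f" using assms by unfold_locales auto
  interpret lr_map f by (rule lr_f)
  show ?thesis
  proof (intro conjI allI impI)
    show "bij f" by (rule bij_F)
    show "affine_dim (f ` A) = affine_dim A" if "left_affine A \<or> right_affine A" for A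
      using that by (rule affine_dim_image)
  next
    fix P :: "('a ^ 'n) set"
    assume *: "CARD('n) \<ge> 3 \<and>
             (\<exists>L\<subseteq>P. purely_left L \<and> affine_dim L = 1 \<and> left_affine (f ` L))"
    then obtain x v where "\<not> central_direction v" "left_affine (f ` left.line x v)"
      using purely_left_line_iff by metis
    then have "pure_pos f" using * pure_posI by blast
    then have "preserves_left_affine f \<and> has_standard_form f"
      using lr_f * by (intro standard_form_pure_pos) auto
    then show "preserves_left_affine f" "has_standard_form f" by auto
  next
    fix P :: "('a ^ 'n) set"
    assume P: "two_sided P \<and> affine_dim P = 2"
    assume *: "CARD('n) \<ge> 2 \<and>
             (\<forall>L\<subseteq>P. purely_left L \<and> affine_dim L = 1 \<longrightarrow> right_affine (f ` L))"
    show "\<exists>\<epsilon>. ring_anti_automorphism \<epsilon> \<and>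
                    preserves_left_affine (componentwise \<epsilon> \<circ> f) \<and>
                    has_standard_form (componentwise \<epsilon> \<circ> f)"
    proof (cases "\<exists>a b :: 'a. a * b \<noteq> b * a")
      \<comment> \<open>Without noncommuting elements all directions are central, so
        \<open>pure_pos\<close> is vacuous and the identity is an anti-automorphism.\<close>
      case False
      then have "ring_anti_automorphism (id :: 'a \<Rightarrow> 'a)"
        by (simp add: ring_anti_automorphism_def)
      moreover have "componentwise id \<circ> f = f" by (simp add: fun_eq_iff componentwise_def)
      moreover have "central_direction (v :: 'a ^ 'n)" for v
        unfolding central_direction_def using False
        by (intro exI[of _ 1] exI[of _ v]) (simp add: left.s_one centre_def)
      then have "pure_pos f" by (simp add: pure_pos_def)
      ultimately show ?thesis using standard_form_pure_pos[OF lr_f] * by metis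
    next
      case True
      let ?F = "componentwise Opp \<circ> f"
      interpret F: lr_map ?F by (intro lr_map_anti_comp lr_f anti_iso_Opp)
      have P': "left_affine P" "pivot_dim (direction P) = 2"
        using P affine_dim_eq_pivot_dim[of P] unfolding two_sided_def by auto
      have F_line: "left_affine (?F ` left.line x v)"
        if "\<not> central_direction v" "left.line x v \<subseteq> P" for x v
        using * that purely_left_line_iff Opp.affine_right unfolding image_comp[symmetric] by metis
      have "pure_pos ?F"
      proof (cases "CARD('n) = 2")
        case True
        have "P = UNIV"
          using P' True affine_strict_mono[of P UNIV] left.affine_UNIV pivot_dim_le_CARD
          by (metis leD psubsetI top_greatest)
        then show ?thesis using F_line unfolding pure_pos_def by blast
      next
        case False
        \<comment> \<open>The hypothesis would be empty if \<open>P\<close> had no purely left line;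
          a single one decides the type of all lines.\<close>
        obtain a b :: 'a where "a * b \<noteq> b * a" using True by blast
        then obtain v where v: "v \<in> direction P" "\<not> central_direction v"
          using exists_pure_direction left.sub_direction P' by metis
        obtain x where "x \<in> P" using left.affine_nonempty P' by blast
        then have "left_affine (?F ` left.line x v)"
          using v P' by (intro F_line left.line_subset)
        then show ?thesis using False * v by (intro F.pure_posI) auto
      qed
      then have "left_map ?F"
        using F.pure_pos_imp_left True * by unfold_locales auto
      then interpret FL: left_map ?F .
      obtain \<sigma> :: "'a \<Rightarrow> 'a opp" where \<sigma>: "bij \<sigma>" "\<And>c d. \<sigma> (c + d) = \<sigma> c + \<sigma> d"
        "\<And>c d. \<sigma> (c * d) = \<sigma> c * \<sigma> d" using FL.semilinear by blast
      \<comment> \<open>Up to translation, \<open>f\<close> takes \<open>c *s x\<close> to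
        \<open>right_scale (unopp (\<sigma> c)) (f x)\<close>. The inverse of
        \<open>unopp \<circ> \<sigma>\<close> undoes this twist and turns right multiples back into
        left ones.\<close>
      define \<epsilon> where "\<epsilon> = inv (unopp \<circ> \<sigma>)"
      have "anti_iso (unopp \<circ> \<sigma>)"
        using \<sigma> anti_iso_unopp unfolding anti_iso_def by (auto intro: bij_comp)
      then have \<epsilon>: "anti_iso \<epsilon>" unfolding \<epsilon>_def by (rule anti_iso_inv)
      interpret \<epsilon>: anti \<epsilon> using \<epsilon> by unfold_locales
      have "lr_map (componentwise \<epsilon> \<circ> f)" by (intro lr_map_anti_comp lr_f \<epsilon>)
      moreover have "pure_pos (componentwise \<epsilon> \<circ> f)"
        unfolding pure_pos_def
      proof (intro allI impI)
        fix x v :: "'a ^ 'n"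
        have "right_affine (componentwise unopp ` ?F ` left.line x v)"
          by (rule unopp.affine_left[OF FL.left_lines])
        then have "right_affine (f ` left.line x v)"
          by (simp add: image_image componentwise_unopp_Opp)
        then show "left_affine ((componentwise \<epsilon> \<circ> f) ` left.line x v)"
          unfolding image_comp[symmetric] by (rule \<epsilon>.affine_right)
      qed
      ultimately have "preserves_left_affine (componentwise \<epsilon> \<circ> f) \<and>
          has_standard_form (componentwise \<epsilon> \<circ> f)"
        using * by (intro standard_form_pure_pos) auto
      moreover have "ring_anti_automorphism \<epsilon>"
        using \<epsilon> unfolding anti_iso_def ring_anti_automorphism_def .
      ultimately show ?thesis by blast
    qed
  qed
qed

end
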